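(* Fix $p\in(0,1)$ and let $P_n$ be the number of distinct directed source-to-sink paths in a random series-parallel network of size $n$ in the Bernoulli model with parameter $p$. Then $$\mathbb{E}(P_n)=\begin{cases}\displaystyle\sum_{j=0}^{n-1}(-1)^{n+j-1}\binom{(2p-1)j-1}{n-1}\sum_{k=0}^{n-1}\binom{k}{j}\Big(\frac{p}{2p-1}\Big)^{k}, & p\neq\tfrac12,\\[3mm] \displaystyle\sum_{k=0}^{n-1}\frac{(-1)^k}{2^k}B_k\big(-H^{(1)}_{n-1},-H^{(2)}_{n-1},-2H^{(3)}_{n-1},\dots,-(k-1)!H^{(k)}_{n-1}\big), & p=\tfrac12,\end{cases}$$ where $B_k(x_1,\dots,x_k)$ is the $k$-th complete Bell polynomial and $H^{(m)}_n=\sum_{j=1}^n j^{-m}$. Asymptotically, as $n\to\infty$, $$\mathbb{E}(P_n)=\frac{1}{1-p}\alpha_p^{\,n}+R_p(n),$$ where $\alpha_p=\Big(1-\big(\tfrac{p}{1-p}\big)^{\frac{1}{1-2p}}\Big)^{-1}$ for $p\ne\tfrac12$ and $\alpha_{1/2}=\frac{1}{1-e^{-2}}$, and $R_p(n)=-\frac{1-2p}{p\,\Gamma(2p)}n^{2p-1}+O(n^{2(2p-1)})$ for $0<p<\tfrac12$; $R_{1/2}(n)=-\frac{2}{\log n}+O\big(\frac{1}{\log^2 n}\big)$; and $R_p(n)=-\frac{2p-1}{1-p}+O(n^{1-2p})$ for $\tfrac12<p<1$.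
   Context: Bernoulli model of series-parallel networks with parameter $p\in(0,1)$: at step $1$ the network is a single edge from the source to the sink; at step $n>1$ one of the $n-1$ edges $(x,y)$ is chosen uniformly at random and with probability $p$ a parallel edge $(x,y)$ is added, with probability $1-p$ the edge is subdivided by a new vertex $z$ into $(x,z),(z,y)$. Size $n$ means the network after step $n$ ($n$ edges). Paths are directed paths following the edge orientation. Binomial coefficients with real upper argument: $\binom{a}{k}=a(a-1)\cdots(a-k+1)/k!$. *)

theory Defs
  imports "HOL-Probability.Probability" "HOL-Library.Landau_Symbols"
begin

text \<open>A network is a list of directed edges (multigraph: parallel edges are distinct
  list entries). The source is vertex 0 and the sink is vertex 1.\<close>

type_synonym network = "(nat \<times> nat) list"

definition sp_source :: nat where "sp_source = 0"
definition sp_sink :: nat where "sp_sink = 1"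

definition fresh_vertex :: "network \<Rightarrow> nat" where
  "fresh_vertex E = Suc (Max (insert sp_sink (insert sp_source (fst ` set E \<union> snd ` set E))))"

definition sp_step :: "real \<Rightarrow> network \<Rightarrow> network pmf" where
  "sp_step p E =
     bind_pmf (pmf_of_set {..<length E}) (\<lambda>i.
     bind_pmf (bernoulli_pmf p) (\<lambda>b.
       return_pmf (if b then E @ [E ! i]
                   else E[i := (fst (E ! i), fresh_vertex E)] @ [(fresh_vertex E, snd (E ! i))])))"

text \<open>sp_net p m is the random network after step m+1, i.e. of size m+1.\<close>
primrec sp_net :: "real \<Rightarrow> nat \<Rightarrow> network pmf" where
  "sp_net p 0 = return_pmf [(sp_source, sp_sink)]"
| "sp_net p (Suc m) = bind_pmf (sp_net p m) (sp_step p)"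

definition path_vertices :: "network \<Rightarrow> nat list \<Rightarrow> nat list" where
  "path_vertices E es = sp_source # map (\<lambda>i. snd (E ! i)) es"

definition st_paths :: "network \<Rightarrow> nat list set" where
  "st_paths E = {es. es \<noteq> [] \<and> set es \<subseteq> {..<length E}
     \<and> fst (E ! hd es) = sp_source
     \<and> (\<forall>k. Suc k < length es \<longrightarrow> fst (E ! (es ! Suc k)) = snd (E ! (es ! k)))
     \<and> snd (E ! last es) = sp_sink
     \<and> distinct (path_vertices E es)}"

definition num_paths :: "network \<Rightarrow> nat" where
  "num_paths E = card (st_paths E)"

definition EP :: "real \<Rightarrow> nat \<Rightarrow> real" where
  "EP p n = measure_pmf.expectation (sp_net p (n - 1)) (\<lambda>E. real (num_paths E))"

definition complete_bell :: "nat \<Rightarrow> (nat \<Rightarrow> real) \<Rightarrow> real" where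
  "complete_bell k x = (\<Sum>P\<in>{P. partition_on {1..k} P}. \<Prod>B\<in>P. x (card B))"

definition gen_harmonic :: "nat \<Rightarrow> nat \<Rightarrow> real" where
  "gen_harmonic m n = (\<Sum>j=1..n. 1 / real j ^ m)"

definition alpha_p :: "real \<Rightarrow> real" where
  "alpha_p p = (if p = 1/2 then 1 / (1 - exp (-2))
                else 1 / (1 - (p / (1 - p)) powr (1 / (1 - 2 * p))))"

definition R_p :: "real \<Rightarrow> nat \<Rightarrow> real" where
  "R_p p n = EP p n - 1 / (1 - p) * alpha_p p ^ n"

end

theory Submission
  imports Defs "HOL-Complex_Analysis.Complex_Analysis" "HOL-Real_Asymp.Real_Asymp"
begin

text \<open>For a network \<open>E\<close> with \<open>n\<close> edges let \<open>A\<^sub>E(y)\<close> be the sum of \<open>y\<close> to the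
  length over all source-to-sink paths. One growth step changes \<open>A\<^sub>E\<close>, on average over the chosen
  edge, through \<open>A\<^sub>E\<close> and \<open>y A\<^sub>E'\<close> only, since doubling an edge doubles the paths through it and
  subdividing it lengthens them by one. Hence, if \<open>\<Psi>\<close> solves \<open>(1 - z) \<Psi>' = - (1 + (2p - 1) \<Psi>)\<close>,
  \<open>\<Psi>(0) = 0\<close>, and \<open>y(z) = 1 / (1 + p \<Psi>(z))\<close>, then differentiating
  \<open>(1 - z)\<^bsup>-n\<^esup> A\<^sub>E(y(z))\<close> amounts to one growth step, and the expected number of paths has
  generating function \<open>1 / ((1 - z)(1 + p \<Psi>(z)))\<close>. Here \<open>\<Psi> = ((1 - z)\<^bsup>2p-1\<^esup> - 1) / (2p - 1)\<close>, or
  \<open>\<Psi> = log (1 - z)\<close> for \<open>p = 1/2\<close>. The geometric series in \<open>p \<Psi>\<close> gives the exact formulas.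

  On the plane slit along \<open>[1, \<infinity>)\<close> the generating function has a single simple pole at
  \<open>1 / \<alpha>\<^sub>p\<close>; once it is removed, the behaviour at \<open>z = 1\<close> determines the remainder. The transfer
  from the function to its coefficients bounds the third derivative by Cauchy's inequality on discs
  of radius \<open>|1 - z| / 3\<close> and integrates it over the circle of radius \<open>1 - 1/n\<close>.\<close>

unbundle fps_syntax
unbundle no vec_syntax

section \<open>Paths and growth steps\<close>

fun walk :: "network \<Rightarrow> nat \<Rightarrow> nat list \<Rightarrow> nat \<Rightarrow> bool" where
  "walk E x [] y \<longleftrightarrow> x = y"
| "walk E x (e # es) y \<longleftrightarrow> e < length E \<and> fst (E ! e) = x \<and> walk E (snd (E ! e)) es y"

lemma walk_iff_successively:
  assumes "es \<noteq> []"
  shows "walk E x es y \<longleftrightarrow> set es \<subseteq> {..<length E} \<and> fst (E ! hd es) = x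
     \<and> successively (\<lambda>d e. fst (E ! e) = snd (E ! d)) es \<and> snd (E ! last es) = y"
  using assms by (induction es arbitrary: x) (auto simp: successively_Cons neq_Nil_conv)

lemma walk_set: "walk E x es y \<Longrightarrow> set es \<subseteq> {..<length E}"
  by (induction es arbitrary: x) auto

lemma mem_st_paths_iff:
  "es \<in> st_paths E \<longleftrightarrow> walk E sp_source es sp_sink \<and> distinct (path_vertices E es)"
proof (cases "es = []")
  case False
  then show ?thesis
    by (auto simp: st_paths_def walk_iff_successively successively_conv_nth)
qed (simp add: st_paths_def sp_source_def sp_sink_def)

lemma st_paths_set: "es \<in> st_paths E \<Longrightarrow> set es \<subseteq> {..<length E}"
  by (simp add: st_paths_def)

lemma st_paths_distinct: "es \<in> st_paths E \<Longrightarrow> distinct es"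
  by (auto simp: mem_st_paths_iff path_vertices_def distinct_map)

lemma finite_st_paths: "finite (st_paths E)"
proof (rule finite_subset)
  show "st_paths E \<subseteq> {es. set es \<subseteq> {..<length E} \<and> distinct es}"
    using st_paths_distinct st_paths_set by blast
  show "finite {es. set es \<subseteq> {..<length E} \<and> distinct es}"
    by (rule finite_subset_distinct) simp
qed

lemma st_paths_single: "st_paths [(sp_source, sp_sink)] = {[0]}"
proof (intro set_eqI iffI)
  fix es assume es: "es \<in> st_paths [(sp_source, sp_sink)]"
  then have "set es \<subseteq> {0}" "distinct es" "es \<noteq> []"
    using st_paths_set[OF es] st_paths_distinct[OF es] by (auto simp: st_paths_def)
  then show "es \<in> {[0]}"
    by (cases es; cases "tl es") auto
qed (auto simp: mem_st_paths_iff path_vertices_def sp_source_def sp_sink_def)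

definition par_net :: "network \<Rightarrow> nat \<Rightarrow> network" where
  "par_net E i = E @ [E ! i]"

definition ser_net :: "network \<Rightarrow> nat \<Rightarrow> network" where
  "ser_net E i = E[i := (fst (E ! i), fresh_vertex E)] @ [(fresh_vertex E, snd (E ! i))]"

lemma length_par_net [simp]: "length (par_net E i) = Suc (length E)"
  and length_ser_net [simp]: "length (ser_net E i) = Suc (length E)"
  by (simp_all add: par_net_def ser_net_def)

lemma nth_par_net:
  "j \<le> length E \<Longrightarrow> par_net E i ! j = E ! (if j = length E then i else j)"
  by (auto simp: par_net_def nth_append)

lemma nth_ser_net:
  assumes "i < length E" "j \<le> length E"
  shows "ser_net E i ! j = (if j = length E then (fresh_vertex E, snd (E ! i))
           else if j = i then (fst (E ! i), fresh_vertex E) else E ! j)"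
  using assms by (auto simp: ser_net_def nth_append)

subsection \<open>Doubling an edge\<close>

lemma mem_st_paths_par_net_iff:
  assumes i: "i < length E"
  shows "es \<in> st_paths (par_net E i) \<longleftrightarrow> map (id(length E := i)) es \<in> st_paths E"
proof -
  have "walk (par_net E i) x es y \<longleftrightarrow> walk E x (map (id(length E := i)) es) y" for x y
  proof (induction es arbitrary: x)
    case (Cons e es)
    then show ?case using i
      by (cases e "length E" rule: linorder_cases) (auto simp: nth_par_net)
  qed simp
  moreover have "path_vertices (par_net E i) es = path_vertices E (map (id(length E := i)) es)"
    if "walk (par_net E i) sp_source es sp_sink"
    using walk_set[OF that] by (auto simp: path_vertices_def nth_par_net less_Suc_eq_le)
  ultimately show ?thesis
    unfolding mem_st_paths_iff by metis
qed

lemma st_paths_par_net: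
  assumes i: "i < length E"
  shows "st_paths (par_net E i) =
           st_paths E \<union> map (id(i := length E)) ` {es \<in> st_paths E. i \<in> set es}"
proof (intro equalityI subsetI)
  fix es assume es: "es \<in> st_paths (par_net E i)"
  let ?es' = "map (id(length E := i)) es"
  have es': "?es' \<in> st_paths E" using es mem_st_paths_par_net_iff[OF i] by blast
  show "es \<in> st_paths E \<union> map (id(i := length E)) ` {es \<in> st_paths E. i \<in> set es}"
  proof (cases "length E \<in> set es")
    case False
    then have "?es' = es" by (intro map_idI) auto
    then show ?thesis using es' by simp
  next
    case True
    have "inj_on (id(length E := i)) (set es)"
      using st_paths_distinct[OF es'] by (simp add: distinct_map)
    then have "i \<notin> set es"
      using True i inj_onD[of "id(length E := i)" "set es" i "length E"] by auto
    then have "es = map (id(i := length E)) ?es'"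
      by (auto intro!: map_idI[symmetric])
    then show ?thesis using es' True by force
  qed
next
  have inverse: "map (id(length E := i)) es = es"
    "map (id(length E := i)) (map (id(i := length E)) es) = es"
    if "es \<in> st_paths E" for es
    using st_paths_set[OF that] unfolding map_map by (auto intro!: map_idI)
  fix es assume "es \<in> st_paths E \<union> map (id(i := length E)) ` {es \<in> st_paths E. i \<in> set es}"
  then consider "es \<in> st_paths E" | es' where "es' \<in> st_paths E" "es = map (id(i := length E)) es'"
    by blast
  then have "map (id(length E := i)) es \<in> st_paths E"
    by cases (simp_all only: inverse)
  then show "es \<in> st_paths (par_net E i)"
    by (simp add: mem_st_paths_par_net_iff[OF i])
qed

lemma sum_st_paths_par_net:
  fixes w :: "nat \<Rightarrow> 'a :: comm_monoid_add"
  assumes i: "i < length E"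
  shows "(\<Sum>es\<in>st_paths (par_net E i). w (length es)) =
           (\<Sum>es\<in>st_paths E. w (length es)) + (\<Sum>es | es \<in> st_paths E \<and> i \<in> set es. w (length es))"
proof -
  let ?new = "map (id(i := length E)) ` {es \<in> st_paths E. i \<in> set es}"
  have set: "set es \<subseteq> {..<length E}" if "es \<in> st_paths E" for es
    using that by (rule st_paths_set)
  have "st_paths E \<inter> ?new = {}"
    using set by force
  then have "(\<Sum>es\<in>st_paths (par_net E i). w (length es)) =
      (\<Sum>es\<in>st_paths E. w (length es)) + (\<Sum>es\<in>?new. w (length es))"
    unfolding st_paths_par_net[OF i] by (intro sum.union_disjoint) (simp_all add: finite_st_paths)
  moreover have "inj_on (map (id(i := length E))) {es \<in> st_paths E. i \<in> set es}"
    by (rule inj_on_subset[OF inj_on_mapI[of _ "{es \<in> st_paths E. i \<in> set es}"]])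
       (use set in \<open>force simp: inj_on_def\<close>)+
  ultimately show ?thesis
    by (simp add: sum.reindex)
qed

subsection \<open>Subdividing an edge\<close>

lemma less_fresh_vertex:
  assumes "x \<in> insert sp_sink (insert sp_source (fst ` set E \<union> snd ` set E))"
  shows "x < fresh_vertex E"
  unfolding fresh_vertex_def using assms by (intro le_imp_less_Suc Max_ge) auto

lemma nth_neq_fresh_vertex:
  assumes "j < length E"
  shows "fst (E ! j) \<noteq> fresh_vertex E" "snd (E ! j) \<noteq> fresh_vertex E"
  using less_fresh_vertex[of "fst (E ! j)" E] less_fresh_vertex[of "snd (E ! j)" E] assms by auto

lemma fresh_vertex_not_terminal:
  "fresh_vertex E \<noteq> sp_source" "fresh_vertex E \<noteq> sp_sink"
  using less_fresh_vertex[of sp_source E] less_fresh_vertex[of sp_sink E] by auto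

definition subdivide :: "nat \<Rightarrow> nat \<Rightarrow> nat list \<Rightarrow> nat list" where
  "subdivide i n es = concat (map (\<lambda>j. if j = i then [i, n] else [j]) es)"

lemma subdivide_simps [simp]:
  "subdivide i n [] = []"
  "subdivide i n (j # es) = (if j = i then i # n # subdivide i n es else j # subdivide i n es)"
  by (simp_all add: subdivide_def)

lemma filter_subdivide: "i \<noteq> n \<Longrightarrow> n \<notin> set es \<Longrightarrow> filter (\<lambda>j. j \<noteq> n) (subdivide i n es) = es"
  by (induction es) auto

lemma length_subdivide: "distinct es \<Longrightarrow> length (subdivide i n es) = length es + of_bool (i \<in> set es)"
  by (induction es) auto

lemma walk_subdivide_iff:
  assumes "i < length E" "set es \<subseteq> {..<length E}"
  shows "walk (ser_net E i) x (subdivide i (length E) es) y \<longleftrightarrow> walk E x es y"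
  using assms by (induction es arbitrary: x) (auto simp: nth_ser_net less_Suc_eq_le)

lemma walk_ser_net_eq_subdivide:
  assumes i: "i < length E" and "walk (ser_net E i) x es y" and y: "y \<noteq> fresh_vertex E"
  obtains es' where "set es' \<subseteq> {..<length E}"
    "es = (if x = fresh_vertex E then length E # subdivide i (length E) es'
           else subdivide i (length E) es')"
  using assms(2)
proof (induction es arbitrary: x thesis)
  case Nil
  then show ?case using y by (intro Nil.prems(1)[of "[]"]) auto
next
  case (Cons e es)
  let ?n = "length E" and ?v = "fresh_vertex E"
  from Cons.prems have e: "e \<le> ?n" "fst (ser_net E i ! e) = x"
    and w: "walk (ser_net E i) (snd (ser_net E i ! e)) es y" by auto
  obtain es' where es': "set es' \<subseteq> {..<?n}"
    "es = (if snd (ser_net E i ! e) = ?v then ?n # subdivide i ?n es' else subdivide i ?n es')"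
    by (rule Cons.IH[OF _ w])
  consider (new) "e = ?n" | (split) "e = i" | (other) "e < ?n" "e \<noteq> i" using e by linarith
  then show ?case
  proof cases
    case new
    then show ?thesis using Cons.prems(1)[of es'] es' e i
      by (auto simp: nth_ser_net nth_neq_fresh_vertex)
  next
    case split
    then show ?thesis using Cons.prems(1)[of "i # es'"] es' e i
      by (auto simp: nth_ser_net nth_neq_fresh_vertex)
  next
    case other
    then show ?thesis using Cons.prems(1)[of "e # es'"] es' e i
      by (auto simp: nth_ser_net nth_neq_fresh_vertex)
  qed
qed

lemma vertices_subdivide:
  assumes "i < length E" "set es \<subseteq> {..<length E}"
  shows "(\<lambda>j. snd (ser_net E i ! j)) ` set (subdivide i (length E) es) =
           (\<lambda>j. snd (E ! j)) ` set es \<union> (if i \<in> set es then {fresh_vertex E} else {})"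
  using assms by (induction es) (auto simp: nth_ser_net)

lemma distinct_vertices_subdivide_iff:
  assumes i: "i < length E" and "distinct es" "set es \<subseteq> {..<length E}" "x \<noteq> fresh_vertex E"
  shows "distinct (x # map (\<lambda>j. snd (ser_net E i ! j)) (subdivide i (length E) es)) \<longleftrightarrow>
           distinct (x # map (\<lambda>j. snd (E ! j)) es)"
  using assms(2-)
proof (induction es arbitrary: x)
  case (Cons e es)
  let ?n = "length E" and ?v = "fresh_vertex E" and ?f = "\<lambda>j. snd (ser_net E i ! j)"
  have e: "e < ?n" "snd (E ! e) \<noteq> ?v" and es: "set es \<subseteq> {..<?n}"
    using Cons.prems(2) by (auto simp: nth_neq_fresh_vertex)
  have IH: "distinct (snd (E ! e) # map ?f (subdivide i ?n es)) \<longleftrightarrow>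
      distinct (snd (E ! e) # map (\<lambda>j. snd (E ! j)) es)"
    using Cons.prems(1) e es by (intro Cons.IH) auto
  have fresh: "?v \<notin> (\<lambda>j. snd (E ! j)) ` set es"
  proof
    assume "?v \<in> (\<lambda>j. snd (E ! j)) ` set es"
    then obtain j where "j \<in> set es" "?v = snd (E ! j)" by blast
    then show False using es nth_neq_fresh_vertex(2)[of j E] by auto
  qed
  show ?case
  proof (cases "e = i")
    case True
    then have "map ?f (subdivide i ?n (e # es)) = ?v # snd (E ! e) # map ?f (subdivide i ?n es)"
      using i by (simp add: nth_ser_net)
    moreover have "?f ` set (subdivide i ?n es) = (\<lambda>j. snd (E ! j)) ` set es"
      using True Cons.prems(1) vertices_subdivide[OF i es] by simp
    ultimately show ?thesis
      using IH fresh e(2) Cons.prems(3) by (simp del: subdivide_simps)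
  next
    case False
    then have "map ?f (subdivide i ?n (e # es)) = snd (E ! e) # map ?f (subdivide i ?n es)"
      using i e by (simp add: nth_ser_net)
    then show ?thesis
      using IH Cons.prems(3) vertices_subdivide[OF i es] by (simp del: subdivide_simps)
  qed
qed simp

lemma st_paths_ser_net:
  assumes i: "i < length E"
  shows "st_paths (ser_net E i) = subdivide i (length E) ` st_paths E"
proof -
  let ?sub = "subdivide i (length E)"
  have iff: "?sub es \<in> st_paths (ser_net E i) \<longleftrightarrow> es \<in> st_paths E"
    if "distinct es" "set es \<subseteq> {..<length E}" for es
    using distinct_vertices_subdivide_iff[OF i that fresh_vertex_not_terminal(1)[symmetric]]
    by (simp add: mem_st_paths_iff path_vertices_def walk_subdivide_iff[OF i that(2)])
  have "es \<in> ?sub ` st_paths E" if es: "es \<in> st_paths (ser_net E i)" for es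
  proof -
    have "walk (ser_net E i) sp_source es sp_sink" using es by (simp add: mem_st_paths_iff)
    then obtain es' where es': "set es' \<subseteq> {..<length E}" "es = ?sub es'"
      using walk_ser_net_eq_subdivide[OF i, of sp_source es sp_sink] fresh_vertex_not_terminal
      by metis
    have "distinct (filter (\<lambda>j. j \<noteq> length E) (?sub es'))"
      using st_paths_distinct[OF es] es'(2) by simp
    then have "distinct es'" using es'(1) i by (subst (asm) filter_subdivide) auto
    then show ?thesis using iff[OF _ es'(1)] es es'(2) by blast
  qed
  then show ?thesis using iff st_paths_distinct st_paths_set by blast
qed

lemma sum_st_paths_ser_net:
  fixes w :: "nat \<Rightarrow> 'a :: comm_monoid_add"
  assumes i: "i < length E"
  shows "(\<Sum>es\<in>st_paths (ser_net E i). w (length es)) =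
           (\<Sum>es\<in>st_paths E. w (length es + of_bool (i \<in> set es)))"
proof -
  have "inj_on (subdivide i (length E)) (st_paths E)"
    using i st_paths_set
    by (intro inj_on_inverseI[where g = "filter (\<lambda>j. j \<noteq> length E)"] filter_subdivide) auto
  then show ?thesis
    by (simp add: st_paths_ser_net[OF i] sum.reindex length_subdivide st_paths_distinct)
qed

section \<open>The generating function of the expected number of paths\<close>

definition path_poly :: "network \<Rightarrow> 'a::comm_semiring_1 \<Rightarrow> 'a" where
  "path_poly E y = (\<Sum>es\<in>st_paths E. y ^ length es)"

lemma sum_edges_st_paths:
  fixes w :: "nat list \<Rightarrow> 'a :: comm_semiring_1"
  shows "(\<Sum>i<length E. \<Sum>es | es \<in> st_paths E \<and> i \<in> set es. w es) =
           (\<Sum>es\<in>st_paths E. of_nat (length es) * w es)"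
proof -
  have "(\<Sum>i<length E. \<Sum>es | es \<in> st_paths E \<and> i \<in> set es. w es) =
      (\<Sum>es\<in>st_paths E. \<Sum>i | i \<in> {..<length E} \<and> i \<in> set es. w es)"
    by (intro sum.swap_restrict finite_st_paths) simp
  also have "\<dots> = (\<Sum>es\<in>st_paths E. of_nat (length es) * w es)"
  proof (intro sum.cong refl)
    fix es assume es: "es \<in> st_paths E"
    have "{i. i \<in> {..<length E} \<and> i \<in> set es} = set es"
      using st_paths_set[OF es] by blast
    then show "(\<Sum>i | i \<in> {..<length E} \<and> i \<in> set es. w es) = of_nat (length es) * w es"
      using st_paths_distinct[OF es] by (simp add: distinct_card)
  qed
  finally show ?thesis .
qed

lemma sum_path_poly_par_net:
  fixes y :: "'a :: comm_semiring_1"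
  shows "(\<Sum>i<length E. path_poly (par_net E i) y) =
           (\<Sum>es\<in>st_paths E. of_nat (length E + length es) * y ^ length es)"
  by (simp add: path_poly_def sum_st_paths_par_net[where w = "\<lambda>k. y ^ k"] sum.distrib
      sum_edges_st_paths sum_distrib_left distrib_right)

lemma sum_path_poly_ser_net:
  fixes y :: "'a :: comm_ring_1"
  shows "(\<Sum>i<length E. path_poly (ser_net E i) y) =
           (\<Sum>es\<in>st_paths E. (of_nat (length E) + of_nat (length es) * (y - 1)) * y ^ length es)"
proof -
  have "path_poly (ser_net E i) y =
      path_poly E y + (\<Sum>es | es \<in> st_paths E \<and> i \<in> set es. (y - 1) * y ^ length es)"
    if "i < length E" for i
  proof -
    have "path_poly (ser_net E i) y =
        (\<Sum>es\<in>st_paths E. y ^ length es + (if i \<in> set es then (y - 1) * y ^ length es else 0))"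
      unfolding path_poly_def sum_st_paths_ser_net[OF that, where w = "\<lambda>k. y ^ k"]
      by (intro sum.cong) (auto simp: algebra_simps)
    then show ?thesis
      by (simp add: path_poly_def sum.distrib sum.inter_filter finite_st_paths)
  qed
  then show ?thesis
    by (simp add: path_poly_def sum.distrib sum_edges_st_paths sum_distrib_left distrib_right
        mult.assoc)
qed

lemma fps_const_affine:
  fixes c :: "'a::comm_ring_1"
  shows "fps_const (1 - c) = 1 - fps_const c" "fps_const (2 * c - 1) = 2 * fps_const c - 1"
  by (simp_all flip: fps_const_sub fps_const_mult add: numeral_fps_const)

lemma fps_deriv_path_poly:
  fixes Y G :: "'a :: comm_ring_1 fps"
  assumes G: "fps_deriv G = G * G"
    and Y: "fps_deriv Y = G * (fps_const (1 - c) * Y + fps_const (2 * c - 1)) * Y"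
  defines "S \<equiv> \<lambda>E. G ^ length E * path_poly E Y"
  shows "fps_deriv (S E) =
           (\<Sum>i<length E. fps_const c * S (par_net E i) + fps_const (1 - c) * S (ser_net E i))"
proof -
  define n where "n = length E"
  let ?c = "fps_const c" and ?d = "fps_const (1 - c)"
  have deriv_power: "fps_deriv (F ^ k) = of_nat k * C * F ^ k"
    if "fps_deriv F = C * F" for k and F C :: "'a fps"
    by (induction k) (simp_all add: that algebra_simps)
  have "fps_deriv (S E) = (\<Sum>es\<in>st_paths E. fps_deriv (G ^ n * Y ^ length es))"
    by (simp add: S_def path_poly_def n_def sum_distrib_left fps_deriv_sum)
  also have "\<dots> = (\<Sum>es\<in>st_paths E. G ^ Suc n * (?c * (of_nat (n + length es) * Y ^ length es)) +
      G ^ Suc n * (?d * ((of_nat n + of_nat (length es) * (Y - 1)) * Y ^ length es)))"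
    unfolding fps_deriv_mult deriv_power[OF G] deriv_power[OF Y] fps_const_affine
    by (intro sum.cong refl) (simp add: algebra_simps)
  also have "\<dots> = G ^ Suc n * (?c * (\<Sum>i<n. path_poly (par_net E i) Y)) +
      G ^ Suc n * (?d * (\<Sum>i<n. path_poly (ser_net E i) Y))"
    unfolding n_def sum_path_poly_par_net sum_path_poly_ser_net
    by (simp only: sum_distrib_left sum.distrib)
  also have "\<dots> = (\<Sum>i<n. ?c * S (par_net E i) + ?d * S (ser_net E i))"
    by (simp add: S_def n_def sum_distrib_left sum.distrib mult.left_commute[of ?c]
        mult.left_commute[of ?d])
  finally show ?thesis unfolding n_def .
qed

lemma sp_step_expectation:
  fixes h :: "network \<Rightarrow> 'a :: {banach, second_countable_topology}"
  assumes p: "0 \<le> p" "p \<le> 1" and E: "E \<noteq> []"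
  shows "measure_pmf.expectation (sp_step p E) h =
           (\<Sum>i<length E. p *\<^sub>R h (par_net E i) + (1 - p) *\<^sub>R h (ser_net E i)) /\<^sub>R real (length E)"
proof -
  have step: "sp_step p E = bind_pmf (pmf_of_set {..<length E})
      (\<lambda>i. map_pmf (\<lambda>b. if b then par_net E i else ser_net E i) (bernoulli_pmf p))"
    unfolding sp_step_def par_net_def ser_net_def map_pmf_def ..
  have "measure_pmf.expectation (map_pmf (\<lambda>b. if b then par_net E i else ser_net E i) (bernoulli_pmf p)) h =
      p *\<^sub>R h (par_net E i) + (1 - p) *\<^sub>R h (ser_net E i)" for i
    using p by (simp add: integral_measure_pmf[of UNIV] UNIV_bool add.commute)
  then show ?thesis
    unfolding step using E
    by (subst pmf_expectation_bind_pmf_of_set) (auto simp: scaleR_right.sum)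
qed

lemma length_sp_step: "E' \<in> set_pmf (sp_step p E) \<Longrightarrow> E \<noteq> [] \<Longrightarrow> length E' = Suc (length E)"
  by (auto simp: sp_step_def split: if_splits)

lemma finite_set_pmf_sp_step: "E \<noteq> [] \<Longrightarrow> finite (set_pmf (sp_step p E))"
  by (simp add: sp_step_def lessThan_empty_iff)

lemma length_sp_net: "E \<in> set_pmf (sp_net p m) \<Longrightarrow> length E = Suc m"
proof (induction m arbitrary: E)
  case (Suc m)
  then obtain E0 where "E0 \<in> set_pmf (sp_net p m)" "E \<in> set_pmf (sp_step p E0)" by auto
  then show ?case using Suc.IH[of E0] length_sp_step[of E p E0] by fastforce
qed simp

lemma sp_net_nonempty: "E \<in> set_pmf (sp_net p m) \<Longrightarrow> E \<noteq> []"
  using length_sp_net by fastforce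

lemma finite_set_pmf_sp_net: "finite (set_pmf (sp_net p m))"
  by (induction m) (auto simp: finite_set_pmf_sp_step sp_net_nonempty)

lemma sp_net_Suc_expectation:
  fixes h :: "network \<Rightarrow> 'a :: {banach, second_countable_topology}"
  shows "measure_pmf.expectation (sp_net p (Suc m)) h =
           measure_pmf.expectation (sp_net p m) (\<lambda>E. measure_pmf.expectation (sp_step p E) h)"
proof -
  have "measure_pmf.expectation (sp_net p (Suc m)) h =
      (\<Sum>E\<in>set_pmf (sp_net p m). pmf (sp_net p m) E *\<^sub>R measure_pmf.expectation (sp_step p E) h)"
    unfolding sp_net.simps
    by (intro pmf_expectation_bind) (auto simp: finite_set_pmf_sp_net finite_set_pmf_sp_step
        sp_net_nonempty)
  then show ?thesis
    by (simp add: integral_measure_pmf[OF finite_set_pmf_sp_net])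
qed

lemma fps_nth_deriv_sp_net_expectation:
  fixes S :: "network \<Rightarrow> 'a :: {real_normed_field, banach, second_countable_topology} fps"
  assumes p: "0 \<le> p" "p \<le> 1"
    and S: "\<And>E. fps_deriv (S E) = (\<Sum>i<length E. fps_const (of_real p) * S (par_net E i) +
              fps_const (1 - of_real p) * S (ser_net E i))"
  shows "fps_nth_deriv m (S [(sp_source, sp_sink)]) $ k =
           fact m * measure_pmf.expectation (sp_net p m) (\<lambda>E. S E $ k)"
proof (induction m arbitrary: k)
  case (Suc m)
  have "fps_nth_deriv (Suc m) (S [(sp_source, sp_sink)]) $ k =
      fact m * measure_pmf.expectation (sp_net p m) (\<lambda>E. fps_deriv (S E) $ k)"
    by (simp only: fps_nth_deriv_commute fps_deriv_nth Suc.IH integral_mult_right_zero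
        mult.left_commute)
  also have "measure_pmf.expectation (sp_net p m) (\<lambda>E. fps_deriv (S E) $ k) =
      measure_pmf.expectation (sp_net p m)
        (\<lambda>E. of_nat (Suc m) * measure_pmf.expectation (sp_step p E) (\<lambda>E'. S E' $ k))"
  proof (intro integral_cong_AE AE_pmfI)
    fix E assume E: "E \<in> set_pmf (sp_net p m)"
    show "fps_deriv (S E) $ k =
        of_nat (Suc m) * measure_pmf.expectation (sp_step p E) (\<lambda>E'. S E' $ k)"
      unfolding S sp_step_expectation[OF p sp_net_nonempty[OF E]] length_sp_net[OF E]
      by (simp add: fps_sum_nth scaleR_conv_of_real del: of_nat_Suc)
  qed simp_all
  also have "\<dots> = of_nat (Suc m) * measure_pmf.expectation (sp_net p (Suc m)) (\<lambda>E. S E $ k)"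
    by (simp only: sp_net_Suc_expectation integral_mult_right_zero)
  finally show ?case by (simp add: mult_ac)
qed simp

definition growth_ode :: "'a::field \<Rightarrow> 'a fps \<Rightarrow> bool" where
  "growth_ode c \<Psi> \<longleftrightarrow> \<Psi> $ 0 = 0 \<and>
     (1 - fps_X) * fps_deriv \<Psi> = - (1 + fps_const (2 * c - 1) * \<Psi>)"

abbreviation fps_geometric :: "'a::field fps" where
  "fps_geometric \<equiv> inverse (1 - fps_X)"

lemma fps_geometric_mult: "(1 - fps_X) * fps_geometric = (1 :: 'a::field fps)"
  by (rule inverse_mult_eq_1') simp

lemma fps_deriv_fps_geometric:
  "fps_deriv fps_geometric = fps_geometric * (fps_geometric :: 'a::field fps)"
  by (simp add: fps_inverse_deriv power2_eq_square)

lemma fps_deriv_inverse_growth_ode: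
  fixes \<Psi> :: "'a::field fps"
  assumes "growth_ode c \<Psi>"
  defines "Y \<equiv> inverse (1 + fps_const c * \<Psi>)"
  shows "fps_deriv Y = fps_geometric * (fps_const (1 - c) * Y + fps_const (2 * c - 1)) * Y"
proof -
  let ?c = "fps_const c"
  define D where "D = 1 + ?c * \<Psi>"
  have \<Psi>: "\<Psi> $ 0 = 0" "(1 - fps_X) * fps_deriv \<Psi> = - (1 + (2 * ?c - 1) * \<Psi>)"
    using assms(1) by (simp_all add: growth_ode_def fps_const_affine)
  have D0: "D $ 0 \<noteq> 0" by (simp add: D_def \<Psi>)
  have "fps_deriv D = ?c * (fps_geometric * ((1 - fps_X) * fps_deriv \<Psi>))"
    using fps_geometric_mult[where 'a = 'a] by (simp add: D_def mult_ac)
  also have "\<dots> = - fps_geometric * ((1 - ?c) + (2 * ?c - 1) * D)"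
    unfolding \<Psi>(2) D_def by (simp add: algebra_simps)
  finally have "fps_deriv (inverse D) =
      fps_geometric * ((1 - ?c) + (2 * ?c - 1) * D) * (inverse D)\<^sup>2"
    by (simp add: fps_inverse_deriv[OF D0])
  also have "\<dots> =
      fps_geometric * ((1 - ?c) * inverse D + (2 * ?c - 1) * (D * inverse D)) * inverse D"
    by (simp add: algebra_simps power2_eq_square)
  finally show ?thesis
    unfolding inverse_mult_eq_1'[OF D0] unfolding fps_const_affine Y_def D_def by simp
qed

theorem EP_eq_coeff:
  fixes \<Psi> :: "'a :: {real_normed_field, banach, second_countable_topology} fps"
  assumes p: "0 \<le> p" "p \<le> 1" and \<Psi>: "growth_ode (of_real p) \<Psi>"
  shows "of_real (EP p (Suc m)) = (fps_geometric * inverse (1 + fps_const (of_real p) * \<Psi>)) $ m"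
proof -
  define Y where "Y = inverse (1 + fps_const (of_real p) * \<Psi>)"
  define S where "S = (\<lambda>E. fps_geometric ^ length E * path_poly E Y)"
  have "\<Psi> $ 0 = 0" using \<Psi> by (simp add: growth_ode_def)
  then have S0: "S E $ 0 = of_real (real (num_paths E))" for E
    by (simp add: S_def Y_def path_poly_def num_paths_def fps_sum_nth fps_power_zeroth)
  have "fact m * S [(sp_source, sp_sink)] $ m = fps_nth_deriv m (S [(sp_source, sp_sink)]) $ 0"
    by (simp add: fps_deriv_maclauren_0)
  also have "\<dots> = fact m * measure_pmf.expectation (sp_net p m) (\<lambda>E. S E $ 0)"
    unfolding S_def Y_def
    by (intro fps_nth_deriv_sp_net_expectation p fps_deriv_path_poly fps_deriv_fps_geometric
        fps_deriv_inverse_growth_ode \<Psi>)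
  also have "\<dots> = fact m * of_real (EP p (Suc m))"
    by (simp add: S0 EP_def integral_measure_pmf[OF finite_set_pmf_sp_net] scaleR_conv_of_real)
  finally have "S [(sp_source, sp_sink)] $ m = of_real (EP p (Suc m))" by simp
  then show ?thesis
    by (simp add: S_def Y_def path_poly_def st_paths_single)
qed

section \<open>Exact formulas\<close>

lemma fps_mult_inverse_one_minus_nth:
  fixes F Q :: "'a :: field fps"
  assumes Q: "Q $ 0 = 0"
  shows "(F * inverse (1 - Q)) $ m = (\<Sum>k\<le>m. (F * Q ^ k) $ m)"
proof -
  have inv: "inverse (1 - Q) * (1 - Q) = 1" by (rule inverse_mult_eq_1) (simp add: Q)
  have "(\<Sum>k\<le>m. Q ^ k) = inverse (1 - Q) * (1 - Q) * (\<Sum>k\<le>m. Q ^ k)"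
    by (simp add: inv)
  also have "\<dots> = inverse (1 - Q) * (1 - Q ^ Suc m)"
    by (simp only: mult.assoc sum_gp_basic)
  finally have "F * (\<Sum>k\<le>m. Q ^ k) = F * (inverse (1 - Q) * (1 - Q ^ Suc m))"
    by (simp only:)
  then have "F * inverse (1 - Q) = (\<Sum>k\<le>m. F * Q ^ k) + F * inverse (1 - Q) * Q ^ Suc m"
    by (simp only: right_diff_distrib mult_1_right sum_distrib_left mult.assoc diff_add_cancel)
  then have "(F * inverse (1 - Q)) $ m =
      ((\<Sum>k\<le>m. F * Q ^ k) + F * inverse (1 - Q) * Q ^ Suc m) $ m"
    by (rule arg_cong)
  moreover have "(F * inverse (1 - Q) * Q ^ Suc m) $ m = 0"
    unfolding fps_mult_nth using startsby_zero_power_prefix[OF Q, of "Suc m"]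
    by (intro sum.neutral) (auto simp: less_Suc_eq_le)
  ultimately show ?thesis by (simp only: fps_add_nth fps_sum_nth add_0_right)
qed

lemma EP_eq_sum_coeff_power:
  fixes \<Psi> :: "real fps"
  assumes p: "0 \<le> p" "p \<le> 1" and \<Psi>: "growth_ode p \<Psi>"
  shows "EP p (Suc m) = (\<Sum>k\<le>m. (- p) ^ k * (fps_geometric * \<Psi> ^ k) $ m)"
proof -
  have "EP p (Suc m) = (fps_geometric * inverse (1 - fps_const (- p) * \<Psi>)) $ m"
    using EP_eq_coeff[of p \<Psi> m] p \<Psi> by (simp flip: fps_const_neg)
  also have "\<dots> = (\<Sum>k\<le>m. (fps_geometric * (fps_const (- p) * \<Psi>) ^ k) $ m)"
    using \<Psi> by (intro fps_mult_inverse_one_minus_nth) (simp add: growth_ode_def)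
  also have "\<dots> = (\<Sum>k\<le>m. (fps_const ((- p) ^ k) * (fps_geometric * \<Psi> ^ k)) $ m)"
    by (simp only: power_mult_distrib fps_const_power mult_ac)
  finally show ?thesis by simp
qed

subsection \<open>The case \<open>p \<noteq> 1/2\<close>\<close>

definition fps_one_minus_powr :: "'a::field_char_0 \<Rightarrow> 'a fps" where
  "fps_one_minus_powr c = fps_compose (fps_binomial c) (- fps_X)"

lemma fps_one_minus_powr_nth [simp]: "fps_one_minus_powr c $ n = (-1) ^ n * (c gchoose n)"
  using fps_compose_linear[of "fps_binomial c" "- 1"]
  by (simp add: fps_one_minus_powr_def flip: fps_const_neg)

lemma fps_one_minus_powr_add:
  "fps_one_minus_powr (c + d) = fps_one_minus_powr c * fps_one_minus_powr d"
  by (simp add: fps_one_minus_powr_def fps_binomial_add_mult fps_compose_mult_distrib)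

lemma fps_one_minus_powr_power: "fps_one_minus_powr c ^ k = fps_one_minus_powr (of_nat k * c)"
  by (simp add: fps_one_minus_powr_def fps_compose_power fps_binomial_power
      flip: fps_binomial_power)

lemma fps_one_minus_powr_minus_one: "fps_one_minus_powr (- 1) = fps_geometric"
  by (simp add: fps_one_minus_powr_def fps_binomial_minus_one fps_inverse_compose
      fps_compose_add_distrib)

lemma fps_deriv_fps_one_minus_powr:
  fixes c :: "'a::field_char_0"
  shows "(1 - fps_X) * fps_deriv (fps_one_minus_powr c) = fps_const (- c) * fps_one_minus_powr c"
proof -
  have "(1 + fps_X) * fps_deriv (fps_binomial c) = fps_const c * fps_binomial c"
    using inverse_mult_eq_1'[of "1 + fps_X :: 'a fps"]
    by (simp add: fps_binomial_deriv fps_divide_unit mult.left_commute)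
  then have "fps_compose ((1 + fps_X) * fps_deriv (fps_binomial c)) (- fps_X) =
      fps_const c * fps_one_minus_powr c"
    by (simp add: fps_one_minus_powr_def fps_compose_mult_distrib)
  then show ?thesis
    by (simp add: fps_one_minus_powr_def fps_compose_mult_distrib fps_compose_add_distrib
        fps_compose_deriv flip: fps_const_neg)
qed

lemma growth_ode_fps_one_minus_powr:
  fixes c :: "'a::field_char_0"
  assumes "2 * c - 1 \<noteq> 0"
  shows "growth_ode c (fps_const (1 / (2 * c - 1)) * (fps_one_minus_powr (2 * c - 1) - 1))"
proof -
  define s where "s = 2 * c - 1"
  have s_nz: "s \<noteq> 0" using assms by (simp add: s_def)
  have "(1 - fps_X) * fps_deriv (fps_const (1 / s) * (fps_one_minus_powr s - 1)) =
      fps_const (1 / s) * ((1 - fps_X) * fps_deriv (fps_one_minus_powr s))"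
    by (simp add: mult_ac)
  also have "\<dots> = - fps_one_minus_powr s"
    unfolding fps_deriv_fps_one_minus_powr using s_nz by (simp flip: mult.assoc fps_const_neg)
  also have "\<dots> = - (1 + fps_const s * (fps_const (1 / s) * (fps_one_minus_powr s - 1)))"
    using s_nz by (simp flip: mult.assoc)
  finally show ?thesis by (simp add: growth_ode_def s_def)
qed

lemma fps_one_minus_powr_binomial_nth:
  fixes c d :: "'a::field_char_0"
  shows "(fps_one_minus_powr d * (1 - fps_one_minus_powr c) ^ k) $ m =
           (\<Sum>j\<le>k. (-1) ^ (m + j) * of_nat (k choose j) * ((c * of_nat j + d) gchoose m))"
proof -
  have "fps_one_minus_powr d * (1 - fps_one_minus_powr c) ^ k =
      (\<Sum>j\<le>k. fps_one_minus_powr d * (of_nat (k choose j) * (- fps_one_minus_powr c) ^ j))"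
    using binomial_ring[of "- fps_one_minus_powr c" 1 k] by (simp add: sum_distrib_left)
  also have "\<dots> = (\<Sum>j\<le>k. fps_const ((-1) ^ j * of_nat (k choose j)) * fps_one_minus_powr (c * of_nat j + d))"
  proof (intro sum.cong refl)
    fix j
    have "(- fps_one_minus_powr c) ^ j = fps_const ((-1) ^ j) * fps_one_minus_powr (of_nat j * c)"
      by (subst power_minus)
         (simp add: fps_one_minus_powr_power flip: fps_const_power fps_const_neg)
    then show "fps_one_minus_powr d * (of_nat (k choose j) * (- fps_one_minus_powr c) ^ j) =
        fps_const ((-1) ^ j * of_nat (k choose j)) * fps_one_minus_powr (c * of_nat j + d)"
      by (simp add: fps_one_minus_powr_add mult_ac flip: fps_of_nat fps_const_mult)
  qed
  finally show ?thesis
    by (simp add: fps_sum_nth power_add mult_ac)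
qed

theorem EP_eq_sum_gbinomial:
  assumes p: "0 \<le> p" "p \<le> 1" "p \<noteq> 1/2"
  shows "EP p (Suc m) = (\<Sum>j\<le>m. (-1) ^ (m + j) * (((2*p - 1) * real j - 1) gchoose m)
               * (\<Sum>k\<le>m. real (k choose j) * (p / (2*p - 1)) ^ k))"
proof -
  define s where "s = 2 * p - 1"
  have s_nz: "s \<noteq> 0" using p by (simp add: s_def)
  define \<Psi> where "\<Psi> = fps_const (1 / s) * (fps_one_minus_powr s - 1)"
  have coeff: "(- p) ^ k * (fps_geometric * \<Psi> ^ k) $ m =
      (\<Sum>j\<le>m. (-1) ^ (m + j) * ((s * real j - 1) gchoose m) * (real (k choose j) * (p / s) ^ k))"
    if k: "k \<le> m" for k
  proof -
    have "fps_const ((- p) ^ k) * \<Psi> ^ k = (fps_const (- p) * \<Psi>) ^ k"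
      by (simp only: power_mult_distrib fps_const_power)
    also have "fps_const (- p) * \<Psi> = fps_const (p / s) * (1 - fps_one_minus_powr s)"
      by (simp add: \<Psi>_def algebra_simps flip: mult.assoc fps_const_neg)
    finally have "fps_const ((- p) ^ k) * (fps_geometric * \<Psi> ^ k) =
        fps_const ((p / s) ^ k) * (fps_one_minus_powr (- 1) * (1 - fps_one_minus_powr s) ^ k)"
      unfolding fps_one_minus_powr_minus_one power_mult_distrib fps_const_power
      by (simp only: mult.left_commute)
    then have "(- p) ^ k * (fps_geometric * \<Psi> ^ k) $ m =
        (p / s) ^ k * (fps_one_minus_powr (- 1) * (1 - fps_one_minus_powr s) ^ k) $ m"
      by (simp only: fps_mult_left_const_nth flip: fps_mult_left_const_nth)
    also have "\<dots> =
        (\<Sum>j\<le>k. (-1) ^ (m + j) * ((s * real j - 1) gchoose m) * (real (k choose j) * (p / s) ^ k))"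
      unfolding fps_one_minus_powr_binomial_nth by (simp add: sum_distrib_left mult_ac)
    also have "\<dots> =
        (\<Sum>j\<le>m. (-1) ^ (m + j) * ((s * real j - 1) gchoose m) * (real (k choose j) * (p / s) ^ k))"
      using k by (intro sum.mono_neutral_left) auto
    finally show ?thesis .
  qed
  have "growth_ode p \<Psi>"
    unfolding \<Psi>_def s_def using s_nz by (intro growth_ode_fps_one_minus_powr) (simp add: s_def)
  then have "EP p (Suc m) = (\<Sum>k\<le>m. (- p) ^ k * (fps_geometric * \<Psi> ^ k) $ m)"
    using p by (intro EP_eq_sum_coeff_power)
  also have "\<dots> = (\<Sum>j\<le>m. \<Sum>k\<le>m.
      (-1) ^ (m + j) * ((s * real j - 1) gchoose m) * (real (k choose j) * (p / s) ^ k))"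
    by (subst sum.swap) (simp add: coeff)
  finally show ?thesis by (simp add: s_def sum_distrib_left)
qed

subsection \<open>Complete Bell polynomials\<close>

lemma sum_Pow_card:
  fixes f :: "nat \<Rightarrow> 'a :: comm_semiring_1"
  assumes "finite A"
  shows "(\<Sum>C\<in>Pow A. f (card C)) = (\<Sum>i\<le>card A. of_nat (card A choose i) * f i)"
proof -
  have "(\<Sum>C\<in>Pow A. f (card C)) = (\<Sum>i\<le>card A. \<Sum>C | C \<in> Pow A \<and> card C = i. f (card C))"
    using assms by (intro sum.group[symmetric]) (auto intro: card_mono)
  also have "\<dots> = (\<Sum>i\<le>card A. of_nat (card A choose i) * f i)"
    using n_subsets[OF assms] by (intro sum.cong refl) simp
  finally show ?thesis .
qed

lemma bij_betw_partition_on_insert: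
  assumes a: "a \<notin> A"
  shows "bij_betw (\<lambda>(C, Q). insert (insert a C) Q)
           (SIGMA C:Pow A. {Q. partition_on (A - C) Q}) {P. partition_on (insert a A) P}"
    (is "bij_betw ?f ?S ?T")
proof (rule bij_betw_byWitness)
  let ?g = "\<lambda>P. (\<Union>{B \<in> P. a \<in> B} - {a}, {B \<in> P. a \<notin> B})"
  have merge: "?g (insert (insert a C) Q) = (C, Q)"
    "partition_on (insert a A) (insert (insert a C) Q)"
    if C: "C \<subseteq> A" and Q: "partition_on (A - C) Q" for C Q
  proof -
    have "a \<notin> B" if "B \<in> Q" for B using that Q a by (auto simp: partition_on_def)
    moreover have "a \<notin> C" using C a by blast
    ultimately have "{B \<in> insert (insert a C) Q. a \<in> B} = {insert a C}" "insert a C - {a} = C"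
      "{B \<in> insert (insert a C) Q. a \<notin> B} = Q" by auto
    then show "?g (insert (insert a C) Q) = (C, Q)" by simp
    have "disjnt (insert a C) (\<Union>Q)" "insert a A - insert a C = A - C"
      using C Q a by (auto simp: partition_on_def disjnt_iff)
    then show "partition_on (insert a A) (insert (insert a C) Q)"
      using C Q partition_on_insert[of "insert a C" Q "insert a A"] by auto
  qed
  have split: "?f (?g P) = P" "?g P \<in> ?S" if P: "partition_on (insert a A) P" for P
  proof -
    obtain B where B: "B \<in> P" "a \<in> B" using P by (auto simp: partition_on_def)
    then have block: "{X \<in> P. a \<in> X} = {B}"
      using P by (auto simp: partition_on_def disjoint_def)
    define Q where "Q = {X \<in> P. a \<notin> X}"
    have P_eq: "P = insert B Q" and insert_B: "insert a (B - {a}) = B"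
      using block B by (auto simp: Q_def)
    have g_eq: "?g P = (B - {a}, Q)" by (simp add: block Q_def)
    show "?f (?g P) = P" unfolding g_eq using P_eq insert_B by simp
    have "disjnt B (\<Union>Q)"
      using P B by (auto simp: partition_on_def Q_def disjnt_iff disjoint_def)
    then have "partition_on (insert a A - B) Q" "B \<subseteq> insert a A"
      using P partition_on_insert[of B Q "insert a A"] P_eq by auto
    moreover from this B(2) a have "insert a A - B = A - (B - {a})" "B - {a} \<subseteq> A" by auto
    ultimately show "?g P \<in> ?S" unfolding g_eq by simp
  qed
  show "\<forall>x\<in>?S. ?g (?f x) = x" "?f ` ?S \<subseteq> ?T"
    using merge by auto
  show "\<forall>P\<in>?T. ?f (?g P) = P" "?g ` ?T \<subseteq> ?S"
    using split by blast+
qed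

lemma sum_partition_on_insert:
  fixes x :: "nat \<Rightarrow> 'a :: comm_semiring_1"
  assumes A: "finite A" "a \<notin> A"
  shows "(\<Sum>P | partition_on (insert a A) P. \<Prod>B\<in>P. x (card B)) =
           (\<Sum>C\<in>Pow A. x (Suc (card C)) * (\<Sum>Q | partition_on (A - C) Q. \<Prod>B\<in>Q. x (card B)))"
proof -
  have prod: "(\<Prod>B\<in>insert (insert a C) Q. x (card B)) = x (Suc (card C)) * (\<Prod>B\<in>Q. x (card B))"
    if C: "C \<subseteq> A" and Q: "partition_on (A - C) Q" for C Q
  proof -
    have "finite Q" using finite_elements[OF _ Q] A by simp
    moreover have "insert a C \<notin> Q" using Q A by (auto simp: partition_on_def)
    moreover have "card (insert a C) = Suc (card C)"
      using C A finite_subset by (subst card_insert_disjoint) auto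
    ultimately show ?thesis by simp
  qed
  have "(\<Sum>P | partition_on (insert a A) P. \<Prod>B\<in>P. x (card B)) =
      (\<Sum>(C, Q)\<in>(SIGMA C:Pow A. {Q. partition_on (A - C) Q}). \<Prod>B\<in>insert (insert a C) Q. x (card B))"
    by (subst sum.reindex_bij_betw[OF bij_betw_partition_on_insert[OF A(2)], symmetric])
       (simp add: case_prod_unfold)
  also have "\<dots> = (\<Sum>C\<in>Pow A. \<Sum>Q | partition_on (A - C) Q. \<Prod>B\<in>insert (insert a C) Q. x (card B))"
    using A(1) by (intro sum.Sigma[symmetric]) (auto intro: finitely_many_partition_on)
  also have "\<dots> = (\<Sum>C\<in>Pow A. x (Suc (card C)) * (\<Sum>Q | partition_on (A - C) Q. \<Prod>B\<in>Q. x (card B)))"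
    by (intro sum.cong refl) (simp add: prod sum_distrib_left)
  finally show ?thesis .
qed

lemma sum_partition_on_eqI:
  fixes x D :: "nat \<Rightarrow> 'a :: comm_semiring_1"
  assumes "finite A" and D0: "D 0 = 1"
    and D: "\<And>n. D (Suc n) = (\<Sum>i\<le>n. of_nat (n choose i) * (x (Suc i) * D (n - i)))"
  shows "(\<Sum>P | partition_on A P. \<Prod>B\<in>P. x (card B)) = D (card A)"
  using assms(1)
proof (induction A rule: finite_psubset_induct)
  case (psubset A)
  show ?case
  proof (cases "A = {}")
    case True
    have "{P. partition_on {} P} = {{} :: 'b set set}" by (auto simp: partition_on_empty)
    then show ?thesis using True D0 by simp
  next
    case False
    then obtain a A' where A: "A = insert a A'" "a \<notin> A'" by (metis mk_disjoint_insert ex_in_conv)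
    with psubset.hyps have finite_A': "finite A'" by simp
    have "(\<Sum>P | partition_on A P. \<Prod>B\<in>P. x (card B)) =
        (\<Sum>C\<in>Pow A'. x (Suc (card C)) * D (card A' - card C))"
      unfolding A(1) sum_partition_on_insert[OF finite_A' A(2)]
    proof (intro sum.cong refl)
      fix C assume C: "C \<in> Pow A'"
      then have "card (A' - C) = card A' - card C"
        using finite_A' finite_subset by (intro card_Diff_subset) auto
      moreover have "A' - C \<subset> A" using A by auto
      ultimately show "x (Suc (card C)) * (\<Sum>Q | partition_on (A' - C) Q. \<Prod>B\<in>Q. x (card B)) =
          x (Suc (card C)) * D (card A' - card C)"
        by (simp add: psubset.IH)
    qed
    also have "\<dots> = D (Suc (card A'))"
      unfolding D using sum_Pow_card[OF finite_A', of "\<lambda>i. x (Suc i) * D (card A' - i)"] by simp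
    finally show ?thesis using A finite_A' by simp
  qed
qed

text \<open>The assumptions characterise \<open>F(u) = exp (\<Sum>\<^sub>i x\<^sub>i u\<^sup>i / i!)\<close>.\<close>

lemma complete_bell_eq_coeff:
  fixes F X :: "real fps"
  assumes "F $ 0 = 1" "fps_deriv F = X * F" "\<And>i. x (Suc i) = fact i * X $ i"
  shows "complete_bell k x = fact k * F $ k"
proof -
  have "complete_bell k x = (\<lambda>k. fact k * F $ k) (card {1..k})"
    unfolding complete_bell_def
  proof (rule sum_partition_on_eqI)
    fix n
    have "fact (Suc n) * F $ Suc n = fact n * fps_deriv F $ n" by (simp add: mult_ac)
    also have "\<dots> = (\<Sum>i\<le>n. fact n * (X $ i * F $ (n - i)))"
      unfolding assms(2) fps_mult_nth by (simp add: sum_distrib_left atMost_atLeast0)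
    also have "\<dots> = (\<Sum>i\<le>n. real (n choose i) * (x (Suc i) * (fact (n - i) * F $ (n - i))))"
      by (intro sum.cong refl) (simp add: assms(3) binomial_fact)
    finally show "fact (Suc n) * F $ Suc n =
      (\<Sum>i\<le>n. real (n choose i) * (x (Suc i) * (fact (n - i) * F $ (n - i))))" .
  qed (simp_all add: assms)
  then show ?thesis by simp
qed

lemma fps_deriv_prod_one_minus:
  fixes c :: "'b \<Rightarrow> 'a :: field"
  assumes "finite A"
  defines "F \<equiv> \<lambda>A. \<Prod>j\<in>A. 1 - fps_const (c j) * fps_X"
  shows "fps_deriv (F A) = Abs_fps (\<lambda>i. - (\<Sum>j\<in>A. c j ^ Suc i)) * F A"
  using assms(1)
proof (induction A)
  case empty
  show ?case by (simp add: F_def fps_zero_def[symmetric])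
next
  case (insert a A)
  define L where "L = 1 - fps_const (c a) * fps_X"
  have F_insert: "F (insert a A) = L * F A"
    using insert.hyps by (simp add: F_def L_def)
  have L_deriv: "Abs_fps (\<lambda>i. - (c a ^ Suc i)) * L = fps_deriv L"
  proof (rule fps_ext)
    fix k show "(Abs_fps (\<lambda>i. - (c a ^ Suc i)) * L) $ k = fps_deriv L $ k"
      by (cases k) (simp_all add: L_def right_diff_distrib mult.left_commute[of _ "fps_const _"])
  qed
  have "Abs_fps (\<lambda>i. - (\<Sum>j\<in>insert a A. c j ^ Suc i)) =
      Abs_fps (\<lambda>i. - (c a ^ Suc i)) + Abs_fps (\<lambda>i. - (\<Sum>j\<in>A. c j ^ Suc i))"
    using insert.hyps by (simp add: fps_eq_iff)
  then show ?case
    unfolding F_insert by (simp add: insert.IH algebra_simps flip: L_deriv)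
qed

lemma complete_bell_power_sums:
  assumes "finite A"
  shows "complete_bell k (\<lambda>m. - fact (m - 1) * (\<Sum>j\<in>A. c j ^ m)) =
           fact k * (\<Prod>j\<in>A. 1 - fps_const (c j) * fps_X) $ k"
proof (rule complete_bell_eq_coeff[OF _ fps_deriv_prod_one_minus[OF assms]])
  show "(\<Prod>j\<in>A. 1 - fps_const (c j) * fps_X) $ 0 = 1"
    using assms by (induction A) auto
qed simp

subsection \<open>The case \<open>p = 1/2\<close>\<close>

definition fps_ln_one_minus :: "'a::field_char_0 fps" where
  "fps_ln_one_minus = fps_compose (fps_ln 1) (- fps_X)"

lemma fps_ln_one_minus_0 [simp]: "fps_ln_one_minus $ 0 = 0"
  by (simp add: fps_ln_one_minus_def)

lemma fps_deriv_fps_ln_one_minus: "fps_deriv fps_ln_one_minus = - fps_geometric"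
  by (simp add: fps_ln_one_minus_def fps_compose_deriv fps_ln_deriv fps_inverse_compose
      fps_compose_add_distrib)

lemma growth_ode_fps_ln_one_minus: "growth_ode (1/2) fps_ln_one_minus"
  using fps_geometric_mult by (simp add: growth_ode_def fps_deriv_fps_ln_one_minus)

lemma one_minus_fps_X_mult_fps_deriv_nth:
  fixes F :: "'a::comm_ring_1 fps"
  shows "((1 - fps_X) * fps_deriv F) $ n = of_nat (Suc n) * F $ Suc n - of_nat n * F $ n"
  by (cases n) (simp_all add: left_diff_distrib)

lemma fps_geometric_ln_power_Suc:
  fixes k N :: nat
  defines "T \<equiv> \<lambda>k. fps_geometric * fps_ln_one_minus ^ k :: 'a::field_char_0 fps"
  shows "of_nat (Suc N) * T (Suc k) $ Suc N =
      of_nat (Suc N) * T (Suc k) $ N - of_nat (Suc k) * T k $ N"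
proof -
  have "(1 - fps_X) * fps_deriv (T (Suc k)) =
      (1 - fps_X) * fps_geometric * (T (Suc k) - of_nat (Suc k) * T k)"
    by (simp add: T_def fps_deriv_power fps_deriv_fps_geometric fps_deriv_fps_ln_one_minus
        fps_of_nat algebra_simps del: of_nat_Suc power_Suc)
  then have "(1 - fps_X) * fps_deriv (T (Suc k)) = T (Suc k) - of_nat (Suc k) * T k"
    by (simp only: fps_geometric_mult mult_1)
  then have "of_nat (Suc N) * T (Suc k) $ Suc N - of_nat N * T (Suc k) $ N =
      T (Suc k) $ N - of_nat (Suc k) * T k $ N"
    by (simp flip: one_minus_fps_X_mult_fps_deriv_nth fps_of_nat del: of_nat_Suc)
  then show ?thesis by (simp add: algebra_simps)
qed

text \<open>Divided by \<open>k!\<close>, both sides are the coefficient of \<open>u\<^sup>k z\<^sup>N\<close> in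
  \<open>(1 - z)\<^bsup>u-1\<^esup> = \<Sum>\<^sub>k (u log (1 - z))\<^sup>k / (k! (1 - z))\<close>.\<close>

lemma fps_geometric_ln_power_nth:
  fixes N :: nat
  shows "(fps_geometric * fps_ln_one_minus ^ k) $ N =
           (fact k * (\<Prod>j=1..N. 1 - fps_const (1 / of_nat j) * fps_X) $ k :: 'a::field_char_0)"
proof (induction N arbitrary: k)
  case 0
  show ?case by (cases k) simp_all
next
  case (Suc N)
  let ?P = "\<lambda>N. \<Prod>j=1..N. 1 - fps_const (1 / of_nat j) * fps_X :: 'a fps"
  have P_Suc: "?P (Suc N) = ?P N - fps_const (1 / of_nat (Suc N)) * (?P N * fps_X)"
    by (simp add: prod.nat_ivl_Suc' algebra_simps)
  show ?case
  proof (cases k)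
    case 0
    then show ?thesis using Suc.IH[of 0] by (simp add: P_Suc fps_inverse_one_minus_fps_X)
  next
    case (Suc l)
    have "of_nat (Suc N) * (fps_geometric * fps_ln_one_minus ^ k) $ Suc N =
        of_nat (Suc N) * (fact k * ?P (Suc N) $ k)"
      unfolding Suc fps_geometric_ln_power_Suc Suc.IH P_Suc
      by (simp add: field_simps del: of_nat_Suc)
    then show ?thesis by (simp del: of_nat_Suc)
  qed
qed

theorem EP_half_eq_sum_complete_bell:
  "EP (1/2) (Suc m) =
     (\<Sum>k\<le>m. (-1) ^ k / 2 ^ k * complete_bell k (\<lambda>j. - fact (j - 1) * gen_harmonic j m))"
proof -
  have "complete_bell k (\<lambda>j. - fact (j - 1) * gen_harmonic j m) =
      (fps_geometric * fps_ln_one_minus ^ k) $ m" for k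
    unfolding gen_harmonic_def fps_geometric_ln_power_nth
    using complete_bell_power_sums[of "{1..m}" k "\<lambda>j. 1 / real j"] by (simp add: power_divide)
  moreover have "(- (1/2)) ^ k = (-1) ^ k / (2 ^ k :: real)" for k
    by (subst power_minus) (simp add: power_divide)
  ultimately show ?thesis
    using EP_eq_sum_coeff_power[OF _ _ growth_ode_fps_ln_one_minus, of m] by simp
qed

section \<open>Transfer of bounds to coefficients\<close>

definition wide_sector :: "complex set" where
  "wide_sector = {z. - norm (1 - z) / 2 < Re (1 - z)}"

lemma open_wide_sector: "open wide_sector"
  unfolding wide_sector_def by (intro open_Collect_less continuous_intros) simp

lemma one_notin_wide_sector: "1 \<notin> wide_sector"
  by (simp add: wide_sector_def)

lemma cball_subset_wide_sector:
  assumes "norm z < 1" "w \<in> cball z (norm (1 - z) / 3)"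
  shows "w \<in> wide_sector"
    and "2 / 3 * norm (1 - z) \<le> norm (1 - w)" "norm (1 - w) \<le> 4 / 3 * norm (1 - z)"
proof -
  have dist_le: "norm ((1 - z) - (1 - w)) \<le> norm (1 - z) / 3"
    using assms(2) by (simp add: dist_norm norm_minus_commute)
  show lower: "2 / 3 * norm (1 - z) \<le> norm (1 - w)"
    using norm_triangle_ineq2[of "1 - z" "1 - w"] dist_le by simp
  show "norm (1 - w) \<le> 4 / 3 * norm (1 - z)"
    using norm_triangle_ineq2[of "1 - w" "1 - z"] dist_le
      norm_minus_commute[of "1 - z" "1 - w"] by simp
  have "Re ((1 - z) - (1 - w)) \<le> norm (1 - z) / 3"
    using complex_Re_le_cmod[of "(1 - z) - (1 - w)"] dist_le by linarith
  moreover have "Re (1 - z) > 0" using assms(1) complex_Re_le_cmod[of z] by simp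
  ultimately show "w \<in> wide_sector" using lower by (simp add: wide_sector_def)
qed

lemma ball_subset_wide_sector: "ball 0 1 \<subseteq> wide_sector"
  using cball_subset_wide_sector(1)[of z z for z] by auto

lemma powr_le_powr_ratio:
  fixes x y b c :: real
  assumes "0 < x" "1 \<le> c" "x / c \<le> y" "y \<le> c * x"
  shows "y powr b \<le> c powr \<bar>b\<bar> * x powr b"
proof -
  have y: "0 < y" using assms by (intro less_le_trans[of 0 "x / c" y]) auto
  have "ln y \<le> ln (c * x)" "ln (x / c) \<le> ln y" using assms y by (subst ln_le_cancel_iff; simp)+
  then have "\<bar>ln y - ln x\<bar> \<le> ln c" using assms by (simp add: ln_mult ln_div)
  then have "\<bar>b\<bar> * \<bar>ln y - ln x\<bar> \<le> \<bar>b\<bar> * ln c" by (rule mult_left_mono) simp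
  moreover have "b * (ln y - ln x) \<le> \<bar>b\<bar> * \<bar>ln y - ln x\<bar>"
    by (metis abs_ge_self abs_mult)
  ultimately have "b * ln y \<le> \<bar>b\<bar> * ln c + b * ln x"
    by (simp add: right_diff_distrib)
  then show ?thesis using assms y by (simp add: powr_def flip: exp_add)
qed

lemma higher_deriv_bound_near_one:
  assumes g: "g holomorphic_on wide_sector" and z: "norm z < 1" and M: "0 \<le> M"
    and bound: "\<And>w. w \<in> cball z (norm (1 - z) / 3) \<Longrightarrow> norm (g w) \<le> M * norm (1 - w) powr (- a)"
  shows "norm ((deriv ^^ k) g z) \<le>
      fact k * 3 ^ k * (3 / 2) powr \<bar>a\<bar> * M * norm (1 - z) powr (- a - real k)"
proof -
  define x where "x = norm (1 - z)"
  have x: "x > 0" using z by (auto simp: x_def)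
  note cball = cball_subset_wide_sector[OF z]
  have "norm ((deriv ^^ k) g z) \<le> fact k * ((3 / 2) powr \<bar>a\<bar> * M * x powr (- a)) / (x / 3) ^ k"
  proof (rule Cauchy_inequality)
    have "cball z (x / 3) \<subseteq> wide_sector" using cball(1) by (auto simp: x_def)
    then have "g holomorphic_on cball z (x / 3)" by (rule holomorphic_on_subset[OF g])
    then show "g holomorphic_on ball z (x / 3)" "continuous_on (cball z (x / 3)) g"
      by (rule holomorphic_on_subset[OF _ ball_subset_cball], rule holomorphic_on_imp_continuous_on)
    fix w assume "norm (z - w) = x / 3"
    then have w: "w \<in> cball z (norm (1 - z) / 3)" by (simp add: dist_norm x_def)
    have "norm (1 - w) powr (- a) \<le> (3 / 2) powr \<bar>- a\<bar> * x powr (- a)"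
      using x cball(2,3)[OF w] by (intro powr_le_powr_ratio) (simp_all add: x_def)
    then have "M * norm (1 - w) powr (- a) \<le> M * ((3 / 2) powr \<bar>a\<bar> * x powr (- a))"
      using M by (intro mult_left_mono) simp_all
    then show "norm (g w) \<le> (3 / 2) powr \<bar>a\<bar> * M * x powr (- a)"
      using bound[OF w] by (simp add: mult_ac)
  qed (use x in simp)
  then show ?thesis
    using x by (simp add: power_divide powr_diff powr_realpow mult_ac flip: x_def)
qed

lemma poisson_integral_circlepath:
  assumes r: "0 < r" "r < 1"
  shows "((\<lambda>t. 1 / (norm (1 - circlepath 0 r t))\<^sup>2) has_integral 1 / (1 - r\<^sup>2)) {0..1}"
proof -
  define c where "c = 2 * complex_of_real pi * \<i>"
  let ?u = "circlepath 0 r"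
  have "((\<lambda>u. 1 / (1 - u) / (u - of_real (r\<^sup>2))) has_contour_integral
      (2 * of_real pi * \<i> * (1 / (1 - of_real (r\<^sup>2))))) ?u"
  proof (rule Cauchy_integral_circlepath_simple)
    show "(\<lambda>u. 1 / (1 - u)) holomorphic_on cball 0 r"
      using r by (intro holomorphic_intros) auto
    have "r\<^sup>2 < r" using r by (simp add: power2_eq_square)
    then show "norm (of_real (r\<^sup>2) - 0 :: complex) < r" by (simp add: norm_power)
  qed
  then have "((\<lambda>t. 1 / c * (1 / (1 - ?u t) / (?u t - of_real (r\<^sup>2)) * vector_derivative ?u (at t)))
      has_integral (1 / c * (c * (1 / (1 - of_real (r\<^sup>2)))))) {0..1}"
    unfolding has_contour_integral c_def by (rule has_integral_mult_right)
  moreover have "1 / c * (1 / (1 - ?u t) / (?u t - of_real (r\<^sup>2)) * vector_derivative ?u (at t)) =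
      of_real (1 / (norm (1 - ?u t))\<^sup>2)" for t
  proof -
    have norm_u: "norm (?u t) = r" using r by (simp add: circlepath norm_mult)
    then have u: "?u t \<noteq> 0" "1 - ?u t \<noteq> 0" using r by auto
    have "complex_of_real (r\<^sup>2) = ?u t * cnj (?u t)"
      using norm_u by (simp add: complex_norm_square [symmetric])
    then have "?u t - of_real (r\<^sup>2) = ?u t * cnj (1 - ?u t)" by (simp add: algebra_simps)
    moreover have "vector_derivative ?u (at t) = c * ?u t"
      unfolding vector_derivative_circlepath by (simp add: c_def circlepath)
    moreover have "complex_of_real (1 / (norm (1 - ?u t))\<^sup>2) = 1 / ((1 - ?u t) * cnj (1 - ?u t))"
      unfolding of_real_divide complex_norm_square by simp
    ultimately show ?thesis
      using u by (simp add: c_def)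
  qed
  ultimately have "((\<lambda>t. complex_of_real (1 / (norm (1 - ?u t))\<^sup>2))
      has_integral of_real (1 / (1 - r\<^sup>2))) {0..1}"
    by (simp add: c_def)
  from has_integral_linear[OF this bounded_linear_Re] show ?thesis
    by (simp add: o_def)
qed

lemma contour_integral_bound_poisson:
  assumes i: "(f has_contour_integral i) (circlepath 0 r)" and r: "0 < r" "r < 1"
    and B: "\<And>u. norm u = r \<Longrightarrow> norm (f u) \<le> B / (norm (1 - u))\<^sup>2"
  shows "norm i \<le> 2 * pi * r * (B / (1 - r\<^sup>2))"
proof -
  let ?F = "\<lambda>t. f (circlepath 0 r t) * vector_derivative (circlepath 0 r) (at t)"
  let ?P = "\<lambda>t. 2 * pi * r * B * (1 / (norm (1 - circlepath 0 r t))\<^sup>2)"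
  have F_integral: "(?F has_integral i) {0..1}"
    using i by (simp only: has_contour_integral)
  have P_integral: "(?P has_integral 2 * pi * r * B * (1 / (1 - r\<^sup>2))) {0..1}"
    by (intro has_integral_mult_right poisson_integral_circlepath r)
  have "norm (integral {0..1} ?F) \<le> integral {0..1} ?P"
  proof (rule integral_norm_bound_integral)
    fix t :: real
    have "norm (f (circlepath 0 r t)) \<le> B / (norm (1 - circlepath 0 r t))\<^sup>2"
      using r by (intro B) (simp add: circlepath norm_mult)
    then have "norm (f (circlepath 0 r t)) * (2 * pi * r) \<le>
        B / (norm (1 - circlepath 0 r t))\<^sup>2 * (2 * pi * r)"
      using r by (intro mult_right_mono) auto
    then show "norm (?F t) \<le> ?P t"
      using r by (simp add: norm_mult vector_derivative_circlepath mult_ac)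
  qed (use F_integral P_integral in \<open>auto simp: has_integral_iff\<close>)
  then show ?thesis using F_integral P_integral by (simp add: has_integral_iff)
qed

lemma coeff_bound_poisson:
  assumes f: "f holomorphic_on ball 0 1" and r: "0 < r" "r < 1"
    and B: "\<And>u. norm u = r \<Longrightarrow> norm (f u) \<le> B / (norm (1 - u))\<^sup>2"
  shows "norm ((deriv ^^ k) f 0 / fact k) \<le> B / (r ^ k * (1 - r\<^sup>2))"
proof -
  have "((\<lambda>u. f u / (u - 0) ^ Suc k) has_contour_integral
      ((2 * pi * \<i>) / fact k * (deriv ^^ k) f 0)) (circlepath 0 r)"
  proof (rule Cauchy_has_contour_integral_higher_derivative_circlepath)
    have "f holomorphic_on cball 0 r" using r by (intro holomorphic_on_subset[OF f]) auto
    then show "continuous_on (cball 0 r) f" "f holomorphic_on ball 0 r"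
      by (rule holomorphic_on_imp_continuous_on, rule holomorphic_on_subset[OF _ ball_subset_cball])
  qed (use r in auto)
  then have "norm ((2 * pi * \<i>) / fact k * (deriv ^^ k) f 0) \<le>
      2 * pi * r * (B / r ^ Suc k / (1 - r\<^sup>2))"
  proof (rule contour_integral_bound_poisson[OF _ r])
    fix u :: complex assume "norm u = r"
    then show "norm (f u / (u - 0) ^ Suc k) \<le> B / r ^ Suc k / (norm (1 - u))\<^sup>2"
      using divide_right_mono[OF B, of u "r ^ Suc k"] r
      by (simp add: norm_divide norm_power norm_mult mult_ac)
  qed
  then have "(2 * pi) * norm ((deriv ^^ k) f 0 / fact k) \<le> (2 * pi) * (B / (r ^ k * (1 - r\<^sup>2)))"
    using r by (simp add: norm_mult norm_divide mult_ac)
  then show ?thesis by (subst (asm) mult_le_cancel_left_pos) auto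
qed

lemma one_minus_inverse_power_bound:
  fixes n k :: nat
  assumes "2 \<le> n" "k < n"
  defines "r \<equiv> 1 - 1 / real n"
  shows "1 / (r ^ k * (1 - r\<^sup>2)) \<le> 3 * real n"
proof -
  have r: "0 < r" "r < 1" using assms(1) by (auto simp: r_def)
  have "1 / r = 1 + 1 / (real n - 1)" using assms(1) by (simp add: r_def field_simps)
  also have "\<dots> \<le> exp (1 / (real n - 1))" by (rule exp_ge_add_one_self)
  finally have "(1 / r) ^ k \<le> exp (1 / (real n - 1)) ^ k" using r by (intro power_mono) auto
  also have "\<dots> = exp (real k / (real n - 1))" by (simp flip: exp_of_nat_mult)
  also have "\<dots> \<le> exp 1" using assms(1,2) by simp
  also have "\<dots> \<le> 3" by (rule exp_le)
  finally have power: "1 / r ^ k \<le> 3" by (simp add: power_divide)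
  have "r\<^sup>2 \<le> r" using r by (simp add: power2_eq_square)
  then have "1 / (1 - r\<^sup>2) \<le> real n"
    using frac_le[of 1 1 "1 / real n" "1 - r\<^sup>2"] assms(1) by (simp add: r_def)
  moreover have "0 \<le> 1 / (1 - r\<^sup>2)" using r by (simp add: power_le_one)
  ultimately have "1 / r ^ k * (1 / (1 - r\<^sup>2)) \<le> 3 * real n"
    using power by (intro mult_mono) auto
  then show ?thesis by simp
qed

text \<open>Three derivatives make the singularity at \<open>1\<close> strong enough for the Poisson kernel to
  dominate it on the circle of radius \<open>1 - 1/n\<close>, so no contour other than circles is needed.\<close>

lemma third_deriv_bound_poisson:
  fixes g :: "complex \<Rightarrow> complex" and a M :: real and n :: nat
  assumes a: "- 1 \<le> a" and n: "2 \<le> n" and M: "0 \<le> M"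
    and hol: "g holomorphic_on wide_sector"
    and bound: "\<And>z. z \<in> wide_sector \<Longrightarrow> 1 / (2 * real n) \<le> norm (1 - z) \<Longrightarrow> norm (1 - z) \<le> 3 \<Longrightarrow>
                  norm (g z) \<le> M * norm (1 - z) powr (- a)"
    and z: "norm z = 1 - 1 / real n"
  shows "norm ((deriv ^^ 3) g z) \<le>
           162 * ((3 / 2) powr \<bar>a\<bar> * M) * real n powr (a + 1) / (norm (1 - z))\<^sup>2"
proof -
  define C where "C = (3 / 2) powr \<bar>a\<bar> * M"
  define x where "x = norm (1 - z)"
  have z1: "norm z < 1" using z n by simp
  have x: "1 / real n \<le> x" "x \<le> 2"
    using norm_triangle_ineq2[of 1 z] norm_triangle_ineq4[of 1 z] z z1
    unfolding x_def norm_one by linarith+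
  then have x0: "0 < x" using n by (intro less_le_trans[of 0 "1 / real n" x]) auto
  have "norm ((deriv ^^ 3) g z) \<le>
      fact 3 * 3 ^ 3 * (3 / 2) powr \<bar>a\<bar> * M * norm (1 - z) powr (- a - real 3)"
  proof (rule higher_deriv_bound_near_one[OF hol z1 M])
    fix w assume "w \<in> cball z (norm (1 - z) / 3)"
    note w = cball_subset_wide_sector[OF z1 this]
    have "1 / (2 * real n) \<le> 2 / 3 * (1 / real n)" using n by (simp add: field_simps)
    then show "norm (g w) \<le> M * norm (1 - w) powr (- a)"
      using w x unfolding x_def by (intro bound) linarith+
  qed
  also have "- a - real 3 = - (a + 1) - real 2" by simp
  also have "norm (1 - z) powr \<dots> = x powr (- (a + 1)) / x\<^sup>2"
    unfolding powr_diff x_def[symmetric] using x0 by (simp add: powr_realpow)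
  also have "fact 3 * 3 ^ 3 * (3 / 2) powr \<bar>a\<bar> * M * (x powr (- (a + 1)) / x\<^sup>2) =
      162 * C * (x powr (- (a + 1)) / x\<^sup>2)"
    by (simp add: C_def fact_numeral)
  also have "x powr (- (a + 1)) \<le> (1 / real n) powr (- (a + 1))"
    using x n a by (intro powr_mono2') auto
  also have "(1 / real n) powr (- (a + 1)) = real n powr (a + 1)"
    by (subst powr_minus, subst powr_divide) auto
  finally show ?thesis using M by (simp add: x_def C_def mult_left_mono divide_right_mono)
qed

lemma cube_le_fact_quotient:
  fixes k :: nat
  shows "2 * real (k + 3) ^ 3 \<le> 9 * (fact (k + 3) / fact k)"
proof -
  have "fact (k + 3) = (real k + 3) * ((real k + 2) * (real k + 1)) * fact k"
    by (simp add: numeral_3_eq_3 algebra_simps)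
  then have "fact (k + 3) / fact k = (real k + 3) * ((real k + 2) * (real k + 1))"
    by simp
  moreover have "2 * (real k + 3)\<^sup>2 \<le> 9 * ((real k + 2) * (real k + 1))"
    by (simp add: power2_eq_square algebra_simps)
  ultimately show ?thesis
    using mult_left_mono[of "2 * (real k + 3)\<^sup>2" "9 * ((real k + 2) * (real k + 1))" "real k + 3"]
    by (simp add: power3_eq_cube power2_eq_square mult_ac)
qed

theorem coeff_bound_wide_sector:
  fixes g :: "complex \<Rightarrow> complex" and a M :: real and n :: nat
  assumes a: "- 1 \<le> a" and n: "3 \<le> n" and M: "0 \<le> M"
    and hol: "g holomorphic_on wide_sector"
    and bound: "\<And>z. z \<in> wide_sector \<Longrightarrow> 1 / (2 * real n) \<le> norm (1 - z) \<Longrightarrow> norm (1 - z) \<le> 3 \<Longrightarrow>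
                  norm (g z) \<le> M * norm (1 - z) powr (- a)"
  shows "norm ((deriv ^^ n) g 0 / fact n) \<le> 3 ^ 7 * (3 / 2) powr \<bar>a\<bar> * M * real n powr (a - 1)"
proof -
  define r where "r = 1 - 1 / real n"
  have r: "0 < r" "r < 1" using n by (auto simp: r_def)
  obtain k where k: "n = k + 3" using n by (metis le_add_diff_inverse2)
  define C where "C = (3 / 2) powr \<bar>a\<bar> * M"
  have C: "0 \<le> C" using M by (simp add: C_def)
  have third_deriv: "norm ((deriv ^^ 3) g z) \<le> 162 * C * real n powr (a + 1) / (norm (1 - z))\<^sup>2"
    if "norm z = r" for z
    unfolding C_def using n that
    by (intro third_deriv_bound_poisson[OF a _ M hol bound]) (simp_all add: r_def)
  have "(deriv ^^ 3) g holomorphic_on ball 0 1"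
    by (rule holomorphic_on_subset[OF holomorphic_higher_deriv[OF hol open_wide_sector]
        ball_subset_wide_sector])
  from coeff_bound_poisson[OF this r third_deriv, of k]
  have "norm ((deriv ^^ n) g 0 / fact k) \<le>
      162 * C * real n powr (a + 1) * (1 / (r ^ k * (1 - r\<^sup>2)))"
    unfolding k funpow_add by simp
  also have "\<dots> \<le> 162 * C * real n powr (a + 1) * (3 * real n)"
    unfolding r_def using k C by (intro mult_left_mono one_minus_inverse_power_bound) auto
  also have "\<dots> = 243 * C * real n powr (a - 1) * (2 * real n ^ 3)"
    using n powr_add[of "real n" "a - 1" 3] powr_add[of "real n" "a + 1" 1]
    by (simp add: add.commute)
  also have "\<dots> \<le> 243 * C * real n powr (a - 1) * (9 * (fact n / fact k))"
    unfolding k using C by (intro mult_left_mono cube_le_fact_quotient) auto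
  finally show ?thesis
    by (simp add: C_def norm_divide field_simps)
qed

section \<open>The generating function on the slit plane\<close>

definition slit_plane :: "complex set" where
  "slit_plane = {z. 1 - z \<notin> \<real>\<^sub>\<le>\<^sub>0}"

lemma open_slit_plane: "open slit_plane"
proof -
  have "slit_plane = (\<lambda>z. 1 - z) -` (- \<real>\<^sub>\<le>\<^sub>0)"
    by (auto simp: slit_plane_def)
  also have "open \<dots>"
    by (intro open_vimage continuous_intros) (simp add: open_Compl)
  finally show ?thesis .
qed

lemma one_notin_slit_plane: "1 \<notin> slit_plane"
  by (simp add: slit_plane_def)

lemma in_slit_planeI:
  assumes "z \<noteq> 1" "- norm (1 - z) / 2 \<le> Re (1 - z)"
  shows "z \<in> slit_plane"
proof (rule ccontr)
  assume "z \<notin> slit_plane"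
  then have re: "Re (1 - z) \<le> 0" and im: "Im (1 - z) = 0"
    by (auto simp: slit_plane_def complex_nonpos_Reals_iff)
  then have "norm (1 - z) = - Re (1 - z)" by (simp add: cmod_eq_Re)
  then have "Re (1 - z) = 0" using re assms(2) by linarith
  with im assms(1) show False by (simp add: complex_eq_iff)
qed

lemma wide_sector_subset_slit_plane: "wide_sector \<subseteq> slit_plane"
  using one_notin_wide_sector by (force simp: wide_sector_def intro!: in_slit_planeI)

lemma ball_subset_slit_plane: "ball 0 1 \<subseteq> slit_plane"
  using ball_subset_wide_sector wide_sector_subset_slit_plane by blast

definition psi :: "real \<Rightarrow> complex \<Rightarrow> complex" where
  "psi p z = (if p = 1/2 then Ln (1 - z)
              else ((1 - z) powr of_real (2 * p - 1) - 1) / of_real (2 * p - 1))"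

definition gf_denom :: "real \<Rightarrow> complex \<Rightarrow> complex" where
  "gf_denom p z = (1 - z) * (1 + of_real p * psi p z)"

lemma psi_0 [simp]: "psi p 0 = 0"
  unfolding psi_def by simp

lemma psi_has_field_derivative:
  assumes z: "z \<in> slit_plane"
  shows "(psi p has_field_derivative (- (1 + of_real (2 * p - 1) * psi p z) / (1 - z))) (at z)"
proof (cases "p = 1/2")
  case True
  have "((\<lambda>z. Ln (1 - z)) has_field_derivative (- 1 / (1 - z))) (at z)"
    using z by (auto intro!: derivative_eq_intros simp: slit_plane_def divide_inverse)
  moreover have "psi (1/2) = (\<lambda>z. Ln (1 - z))" by (simp add: psi_def fun_eq_iff)
  ultimately show ?thesis unfolding True by simp
next
  case False
  define s where "s = complex_of_real (2 * p - 1)"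
  have s_nz: "s \<noteq> 0" using False unfolding s_def of_real_eq_0_iff by simp
  have psi_eq: "psi p = (\<lambda>z. ((1 - z) powr s - 1) / s)"
    using False by (simp add: psi_def s_def fun_eq_iff)
  have nz: "1 - z \<noteq> 0" using z one_notin_slit_plane by auto
  have "((\<lambda>z. ((1 - z) powr s - 1) / s) has_field_derivative (- ((1 - z) powr (s - 1)))) (at z)"
    using z s_nz by (auto intro!: derivative_eq_intros simp: slit_plane_def)
  moreover have "- ((1 - z) powr (s - 1)) = - (1 + s * psi p z) / (1 - z)"
    using nz s_nz by (simp add: psi_eq powr_diff)
  ultimately show ?thesis by (simp add: psi_eq s_def)
qed

lemma holomorphic_psi: "psi p holomorphic_on slit_plane"
  using psi_has_field_derivative holomorphic_on_open[OF open_slit_plane] by blast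

lemma holomorphic_gf_denom: "gf_denom p holomorphic_on slit_plane"
  unfolding gf_denom_def by (intro holomorphic_intros holomorphic_psi)

lemma gf_denom_has_field_derivative:
  assumes z: "z \<in> slit_plane"
  shows "(gf_denom p has_field_derivative
           (- (1 + of_real p * psi p z) - of_real p * (1 + of_real (2 * p - 1) * psi p z))) (at z)"
proof -
  have nz: "1 - z \<noteq> 0" using z one_notin_slit_plane by auto
  have "((\<lambda>z. (1 - z) * (1 + of_real p * psi p z)) has_field_derivative
      (0 - 1) * (1 + of_real p * psi p z) +
      (0 + of_real p * (- (1 + of_real (2 * p - 1) * psi p z) / (1 - z))) * (1 - z)) (at z)"
    by (intro DERIV_mult DERIV_add DERIV_diff DERIV_const DERIV_ident DERIV_cmult
        psi_has_field_derivative z)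
  moreover have "(0 - 1) * u + (0 + c * (- v / (1 - z))) * (1 - z) = - u - c * v" for u v c
    using nz by simp
  ultimately show ?thesis unfolding gf_denom_def by (simp only:)
qed

subsection \<open>Power series expansion\<close>

lemma growth_ode_fps_expansion_psi: "growth_ode (of_real p) (fps_expansion (psi p) 0)"
proof -
  let ?A = "fps_expansion (psi p) 0" and ?s = "complex_of_real (2 * p - 1)"
  have zero: "0 \<in> slit_plane" using ball_subset_slit_plane by auto
  have psi_fps: "psi p has_fps_expansion ?A"
    by (rule has_fps_expansion_fps_expansion[OF open_slit_plane zero holomorphic_psi])
  have "eventually (\<lambda>z. (1 - z) * deriv (psi p) z = - (1 + ?s * psi p z)) (nhds 0)"
    using eventually_nhds_in_open[OF open_slit_plane zero]
  proof eventually_elim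
    case (elim z)
    have "1 - z \<noteq> 0" using elim one_notin_slit_plane by auto
    then show ?case
      using DERIV_imp_deriv[OF psi_has_field_derivative[OF elim, of p]] by simp
  qed
  note has_fps_expansion_cong[OF this refl]
  moreover have "(\<lambda>z. (1 - z) * deriv (psi p) z) has_fps_expansion (1 - fps_X) * fps_deriv ?A"
    by (intro fps_expansion_intros psi_fps)
  ultimately have "(\<lambda>z. - (1 + ?s * psi p z)) has_fps_expansion (1 - fps_X) * fps_deriv ?A"
    by (rule iffD1)
  moreover have "(\<lambda>z. - (1 + ?s * psi p z)) has_fps_expansion - (1 + fps_const ?s * ?A)"
    by (intro fps_expansion_intros psi_fps)
  ultimately have "(1 - fps_X) * fps_deriv ?A = - (1 + fps_const ?s * ?A)"
    by (rule fps_expansion_unique_complex)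
  then show ?thesis by (simp add: growth_ode_def fps_expansion_def)
qed

lemma gf_has_fps_expansion:
  assumes p: "0 \<le> p" "p \<le> 1"
  shows "(\<lambda>z. 1 / gf_denom p z) has_fps_expansion Abs_fps (\<lambda>m. complex_of_real (EP p (Suc m)))"
proof -
  let ?A = "fps_expansion (psi p) 0"
  have psi_fps: "psi p has_fps_expansion ?A"
    using ball_subset_slit_plane
    by (intro has_fps_expansion_fps_expansion[OF open_slit_plane _ holomorphic_psi]) auto
  have "(\<lambda>z. inverse (gf_denom p z)) has_fps_expansion
      inverse ((1 - fps_X) * (1 + fps_const (of_real p) * ?A))"
    unfolding gf_denom_def by (intro fps_expansion_intros psi_fps) (simp add: fps_expansion_def)
  also have "inverse ((1 - fps_X) * (1 + fps_const (of_real p) * ?A)) =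
      Abs_fps (\<lambda>m. complex_of_real (EP p (Suc m)))"
    by (simp add: fps_eq_iff EP_eq_coeff[OF p growth_ode_fps_expansion_psi] fps_inverse_mult)
  finally show ?thesis by (simp add: inverse_eq_divide)
qed

subsection \<open>The pole\<close>

definition pole_log :: "real \<Rightarrow> real" where
  "pole_log p = (if p = 1/2 then - 2 else ln ((1 - p) / p) / (2 * p - 1))"

definition gf_pole :: "real \<Rightarrow> real" where
  "gf_pole p = 1 - exp (pole_log p)"

lemma pole_log_neg:
  assumes "0 < p" "p < 1"
  shows "pole_log p < 0"
proof -
  consider (half) "p = 1/2" | (below) "p < 1/2" | (above) "p > 1/2" by linarith
  then show ?thesis
  proof cases
    case below
    then have "ln ((1 - p) / p) > 0" using assms by (intro ln_gt_zero) (simp add: field_simps)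
    with below show ?thesis by (simp add: pole_log_def divide_pos_neg)
  next
    case above
    then have "ln ((1 - p) / p) < 0" using assms by (intro ln_less_zero) (simp_all add: field_simps)
    with above show ?thesis by (simp add: pole_log_def divide_neg_pos)
  qed (simp add: pole_log_def)
qed

lemma gf_pole_bounds: "0 < p \<Longrightarrow> p < 1 \<Longrightarrow> 0 < gf_pole p \<and> gf_pole p < 1"
  using pole_log_neg by (simp add: gf_pole_def)

lemma gf_pole_in_slit_plane: "0 < p \<Longrightarrow> p < 1 \<Longrightarrow> of_real (gf_pole p) \<in> slit_plane"
  using gf_pole_bounds ball_subset_slit_plane by (force simp: subset_iff)

lemma alpha_p_eq:
  assumes "0 < p" "p < 1"
  shows "alpha_p p = 1 / gf_pole p"
proof (cases "p = 1/2")
  case False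
  have "(p / (1 - p)) powr (1 / (1 - 2 * p)) = exp (1 / (1 - 2 * p) * ln (p / (1 - p)))"
    using assms by (simp add: powr_def)
  also have "ln (p / (1 - p)) = - ln ((1 - p) / p)"
    using assms by (simp add: ln_div)
  also have "1 / (1 - 2 * p) * - ln ((1 - p) / p) = pole_log p"
    using False by (simp add: pole_log_def divide_simps) (simp add: algebra_simps)
  finally show ?thesis using False by (simp add: alpha_p_def gf_pole_def)
qed (simp add: alpha_p_def gf_pole_def pole_log_def)

lemma Ln_eq_of_real_iff:
  fixes w :: complex
  assumes "w \<noteq> 0"
  shows "Ln w = of_real c \<longleftrightarrow> w = of_real (exp c)"
proof
  assume "Ln w = of_real c"
  then show "w = of_real (exp c)" using exp_Ln[OF assms] by (simp add: exp_of_real)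
qed (simp add: Ln_of_real)

lemma powr_of_real_eq_of_real_iff:
  fixes w :: complex and s R :: real
  assumes w: "w \<notin> \<real>\<^sub>\<le>\<^sub>0" and s: "s \<noteq> 0" "\<bar>s\<bar> \<le> 1" and R: "0 < R"
  shows "w powr of_real s = of_real R \<longleftrightarrow> Ln w = of_real (ln R / s)"
proof -
  have w0: "w \<noteq> 0" using w by auto
  have "\<bar>Im (of_real s * Ln w)\<bar> \<le> 1 * \<bar>Im (Ln w)\<bar>"
    using mult_right_mono[OF s(2), of "\<bar>Im (Ln w)\<bar>"] by (simp add: abs_mult)
  also have "\<dots> < pi" using Im_Ln_less_pi[OF w] mpi_less_Im_Ln[OF w0] by simp
  finally have principal: "Ln (w powr of_real s) = of_real s * Ln w"
    unfolding powr_def using w0 by (simp add: abs_less_iff)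
  have "w powr of_real s = of_real R \<longleftrightarrow> Ln (w powr of_real s) = of_real (ln R)"
    using w0 R by (simp add: Ln_eq_of_real_iff)
  also have "\<dots> \<longleftrightarrow> Ln w = of_real (ln R / s)"
    unfolding principal using s by (auto simp: field_simps)
  finally show ?thesis .
qed

lemma one_plus_psi_eq:
  assumes "p \<noteq> 1/2"
  shows "1 + of_real p * psi p z =
           (of_real p * (1 - z) powr of_real (2 * p - 1) - of_real (1 - p)) / of_real (2 * p - 1)"
proof -
  have "complex_of_real (2 * p - 1) \<noteq> 0" using assms unfolding of_real_eq_0_iff by simp
  then show ?thesis using assms by (simp add: psi_def field_simps)
qed

lemma one_plus_psi_eq_0_iff:
  assumes p: "0 < p" "p < 1" and z: "z \<in> slit_plane"
  shows "1 + of_real p * psi p z = 0 \<longleftrightarrow> z = of_real (gf_pole p)"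
proof -
  have z': "1 - z \<notin> \<real>\<^sub>\<le>\<^sub>0" using z by (simp add: slit_plane_def)
  then have z1: "1 - z \<noteq> 0" by auto
  have "1 + of_real p * psi p z = 0 \<longleftrightarrow> Ln (1 - z) = of_real (pole_log p)"
  proof (cases "p = 1/2")
    case True
    have "1 + complex_of_real (1/2) * L = 0 \<longleftrightarrow> L = - 2" for L
      by (auto simp: add_eq_0_iff field_simps minus_equation_iff[of L])
    then show ?thesis unfolding True psi_def pole_log_def by simp
  next
    case False
    have "complex_of_real (2 * p - 1) \<noteq> 0" using False unfolding of_real_eq_0_iff by simp
    then have "1 + of_real p * psi p z = 0 \<longleftrightarrow>
        of_real p * (1 - z) powr of_real (2 * p - 1) = of_real (1 - p)"
      unfolding one_plus_psi_eq[OF False] by simp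
    also have "\<dots> \<longleftrightarrow> (1 - z) powr of_real (2 * p - 1) = of_real ((1 - p) / p)"
      using p by (simp add: field_simps)
    also have "\<dots> \<longleftrightarrow> Ln (1 - z) = of_real (pole_log p)"
      using False p by (subst powr_of_real_eq_of_real_iff[OF z']) (auto simp: pole_log_def)
    finally show ?thesis .
  qed
  also have "\<dots> \<longleftrightarrow> 1 - z = of_real (exp (pole_log p))"
    by (rule Ln_eq_of_real_iff[OF z1])
  also have "\<dots> \<longleftrightarrow> z = of_real (gf_pole p)"
    by (auto simp: gf_pole_def algebra_simps)
  finally show ?thesis .
qed

lemma gf_denom_eq_0_iff:
  "0 < p \<Longrightarrow> p < 1 \<Longrightarrow> z \<in> slit_plane \<Longrightarrow> gf_denom p z = 0 \<longleftrightarrow> z = of_real (gf_pole p)"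
  using one_plus_psi_eq_0_iff one_notin_slit_plane by (auto simp: gf_denom_def)

lemma deriv_gf_denom_pole:
  assumes p: "0 < p" "p < 1"
  shows "deriv (gf_denom p) (of_real (gf_pole p)) = - of_real (1 - p)"
proof -
  let ?a = "complex_of_real (gf_pole p)"
  have "of_real p * psi p ?a = - 1"
    using one_plus_psi_eq_0_iff[OF p gf_pole_in_slit_plane[OF p]] by (simp add: add_eq_0_iff)
  moreover have "deriv (gf_denom p) ?a =
      - (1 + of_real p * psi p ?a) - of_real p - of_real (2 * p - 1) * (of_real p * psi p ?a)"
    using DERIV_imp_deriv[OF gf_denom_has_field_derivative[OF gf_pole_in_slit_plane[OF p], of p]]
    by (simp add: algebra_simps)
  ultimately show ?thesis by simp
qed

lemma holomorphic_inverse_minus_simple_pole: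
  assumes S: "open S" "a \<in> S" and f: "f holomorphic_on S"
    and a: "f a = 0" "deriv f a \<noteq> 0" and nz: "\<And>z. z \<in> S \<Longrightarrow> z \<noteq> a \<Longrightarrow> f z \<noteq> 0"
  obtains h where "h holomorphic_on S"
    "\<And>z. z \<in> S \<Longrightarrow> z \<noteq> a \<Longrightarrow> h z = 1 / f z - 1 / (deriv f a * (z - a))"
proof -
  define q where "q = (\<lambda>z. if z = a then deriv f a else (f z - f a) / (z - a))"
  have "q holomorphic_on S"
    unfolding q_def by (intro pole_lemma_open f S)
  moreover have "q z \<noteq> 0" if "z \<in> S" for z
    using nz[OF that] a by (auto simp: q_def)
  ultimately have "(\<lambda>z. 1 / q z) holomorphic_on S"
    by (intro holomorphic_intros) auto
  then have "(\<lambda>z. if z = a then deriv (\<lambda>z. 1 / q z) a else (1 / q z - 1 / q a) / (z - a))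
      holomorphic_on S"
    by (intro pole_lemma_open S)
  then show ?thesis
    by (rule that) (use a nz in \<open>auto simp: q_def field_simps\<close>)
qed

subsection \<open>Removing the pole\<close>

lemma has_fps_expansion_simple_pole:
  fixes c b :: complex
  assumes "c \<noteq> 0" "b \<noteq> 0"
  shows "(\<lambda>z. 1 / (c * (b - z))) has_fps_expansion Abs_fps (\<lambda>n. 1 / c * (1 / b) ^ Suc n)"
proof -
  have "(\<lambda>z. inverse (c * (b - z))) has_fps_expansion inverse (fps_const c * (fps_const b - fps_X))"
    using assms by (intro fps_expansion_intros) auto
  moreover have "inverse (fps_const c * (fps_const b - fps_X)) =
      Abs_fps (\<lambda>n. 1 / c * (1 / b) ^ Suc n)"
  proof (rule fps_inverse_unique, rule fps_ext)
    fix n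
    show "(fps_const c * (fps_const b - fps_X) * Abs_fps (\<lambda>n. 1 / c * (1 / b) ^ Suc n)) $ n =
        (1 :: complex fps) $ n"
      using assms by (cases n) (simp_all add: mult.assoc left_diff_distrib)
  qed
  ultimately show ?thesis by (simp add: inverse_eq_divide)
qed

lemma gf_minus_pole:
  assumes p: "0 < p" "p < 1"
  obtains h where "h holomorphic_on slit_plane"
    and "h has_fps_expansion Abs_fps (\<lambda>m. complex_of_real (R_p p (Suc m)))"
    and "\<And>z. z \<in> slit_plane \<Longrightarrow> z \<noteq> of_real (gf_pole p) \<Longrightarrow>
           h z = 1 / gf_denom p z - 1 / (of_real (1 - p) * (of_real (gf_pole p) - z))"
proof -
  let ?a = "complex_of_real (gf_pole p)"
  note a_in = gf_pole_in_slit_plane[OF p]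
  have p1_nz: "complex_of_real (1 - p) \<noteq> 0" using p unfolding of_real_eq_0_iff by simp
  obtain h where h: "h holomorphic_on slit_plane"
    "\<And>z. z \<in> slit_plane \<Longrightarrow> z \<noteq> ?a \<Longrightarrow> h z = 1 / gf_denom p z - 1 / (deriv (gf_denom p) ?a * (z - ?a))"
    using holomorphic_inverse_minus_simple_pole[OF open_slit_plane a_in holomorphic_gf_denom]
      gf_denom_eq_0_iff[OF p] a_in deriv_gf_denom_pole[OF p] p1_nz by (metis neg_equal_0_iff_equal)
  have h_eq: "h z = 1 / gf_denom p z - 1 / (of_real (1 - p) * (?a - z))"
    if "z \<in> slit_plane" "z \<noteq> ?a" for z
    unfolding h(2)[OF that] deriv_gf_denom_pole[OF p] by (metis minus_diff_eq minus_mult_commute)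
  have "?a \<noteq> 0" using gf_pole_bounds[OF p] by simp
  then have "(\<lambda>z. 1 / gf_denom p z - 1 / (of_real (1 - p) * (?a - z))) has_fps_expansion
      Abs_fps (\<lambda>m. complex_of_real (EP p (Suc m))) -
      Abs_fps (\<lambda>n. 1 / of_real (1 - p) * (1 / ?a) ^ Suc n)"
    using p p1_nz
    by (intro has_fps_expansion_diff gf_has_fps_expansion has_fps_expansion_simple_pole) auto
  also have "Abs_fps (\<lambda>m. complex_of_real (EP p (Suc m))) -
      Abs_fps (\<lambda>n. 1 / of_real (1 - p) * (1 / ?a) ^ Suc n) =
      Abs_fps (\<lambda>m. complex_of_real (R_p p (Suc m)))"
    by (simp add: fps_eq_iff R_p_def alpha_p_eq[OF p])
  moreover have "eventually (\<lambda>z. z \<in> slit_plane - {?a}) (nhds 0)"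
    using \<open>?a \<noteq> 0\<close> ball_subset_slit_plane open_slit_plane by (intro eventually_nhds_in_open) auto
  then have "eventually (\<lambda>z. 1 / gf_denom p z - 1 / (of_real (1 - p) * (?a - z)) = h z) (nhds 0)"
    by eventually_elim (use h_eq in auto)
  ultimately have "h has_fps_expansion Abs_fps (\<lambda>m. complex_of_real (R_p p (Suc m)))"
    using has_fps_expansion_cong by metis
  with h(1) h_eq show ?thesis using that by blast
qed

lemma norm_diff_inverse_le:
  fixes a w z :: "'a::real_normed_field"
  assumes "norm (w - z) \<le> norm (a - w) / 2" "a \<noteq> w"
  shows "a \<noteq> z" "norm (1 / (a - w) - 1 / (a - z)) \<le> 2 / (norm (a - w))\<^sup>2 * norm (w - z)"
proof -
  have pos: "0 < norm (a - w)" using assms(2) by simp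
  have lower: "norm (a - w) / 2 \<le> norm (a - z)"
    using norm_triangle_ineq2[of "a - w" "z - w"] assms(1) norm_minus_commute[of z w] by simp
  with pos show "a \<noteq> z" by auto
  have "1 / (a - w) - 1 / (a - z) = (w - z) / ((a - w) * (a - z))"
    using assms(2) \<open>a \<noteq> z\<close> by (simp add: divide_simps)
  also have "norm \<dots> \<le> norm (w - z) / (norm (a - w) * (norm (a - w) / 2))"
    unfolding norm_divide norm_mult using lower pos \<open>a \<noteq> z\<close>
    by (intro divide_left_mono mult_left_mono mult_pos_pos) auto
  finally show "norm (1 / (a - w) - 1 / (a - z)) \<le> 2 / (norm (a - w))\<^sup>2 * norm (w - z)"
    by (simp add: power2_eq_square mult_ac)
qed

text \<open>Adding back the value \<open>d\<close> at \<open>1\<close> of the subtracted pole changes only the constant coefficient,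
  and makes the difference vanish at \<open>1\<close>.\<close>

lemma gf_regular_part:
  assumes p: "0 < p" "p < 1"
  obtains h D d where "h holomorphic_on slit_plane" "0 \<le> D"
    and "h has_fps_expansion Abs_fps (\<lambda>m. complex_of_real (R_p p (Suc m))) + fps_const d"
    and "\<And>z. z \<in> slit_plane \<Longrightarrow> norm (1 - z) \<le> (1 - gf_pole p) / 2 \<Longrightarrow>
           norm (h z - 1 / gf_denom p z) \<le> D * norm (1 - z)"
proof -
  let ?a = "complex_of_real (gf_pole p)"
  obtain h where h: "h holomorphic_on slit_plane"
    "h has_fps_expansion Abs_fps (\<lambda>m. complex_of_real (R_p p (Suc m)))"
    and h_eq: "\<And>z. z \<in> slit_plane \<Longrightarrow> z \<noteq> ?a \<Longrightarrow>
      h z = 1 / gf_denom p z - 1 / (of_real (1 - p) * (?a - z))"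
    using gf_minus_pole[OF p] by blast
  have "norm (?a - 1) = norm (complex_of_real (gf_pole p - 1))" by simp
  then have norm_a: "norm (?a - 1) = 1 - gf_pole p"
    using gf_pole_bounds[OF p] unfolding norm_of_real by simp
  then have a1: "?a \<noteq> 1" using gf_pole_bounds[OF p] by auto
  define d where "d = 1 / (of_real (1 - p) * (?a - 1))"
  define D where "D = 2 / ((1 - p) * (1 - gf_pole p)\<^sup>2)"
  show ?thesis
  proof (rule that[of "\<lambda>z. h z + d" D d])
    fix z assume z: "z \<in> slit_plane" "norm (1 - z) \<le> (1 - gf_pole p) / 2"
    note near = norm_diff_inverse_le[of 1 z ?a, unfolded norm_a, OF z(2) a1]
    have "h z + d - 1 / gf_denom p z = 1 / of_real (1 - p) * (1 / (?a - 1) - 1 / (?a - z))"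
      using h_eq[OF z(1)] near(1) by (simp add: d_def right_diff_distrib)
    also have "norm \<dots> = 1 / (1 - p) * norm (1 / (?a - 1) - 1 / (?a - z))"
      using p by (simp add: norm_mult norm_divide del: of_real_diff)
    also have "\<dots> \<le> 1 / (1 - p) * (2 / (1 - gf_pole p)\<^sup>2 * norm (1 - z))"
      using near(2) p by (intro mult_left_mono) auto
    finally show "norm (h z + d - 1 / gf_denom p z) \<le> D * norm (1 - z)"
      by (simp add: D_def)
  qed (use p in \<open>auto simp: D_def intro!: holomorphic_intros has_fps_expansion_add h\<close>)
qed

subsection \<open>The transfer\<close>

lemma bounded_wide_sector_annulus:
  assumes g: "g holomorphic_on slit_plane" and \<epsilon>: "0 < \<epsilon>"
  obtains B where "0 \<le> B" "\<And>z. z \<in> wide_sector \<Longrightarrow> \<epsilon> \<le> norm (1 - z) \<Longrightarrow> norm (1 - z) \<le> b \<Longrightarrow>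
      norm (g z) \<le> B * norm (1 - z) powr c"
proof -
  define A where "A = {z. - norm (1 - z) / 2 \<le> Re (1 - z)} \<inter> {z. \<epsilon> \<le> norm (1 - z)} \<inter> cball 1 b"
  have "compact A"
    unfolding A_def
    by (intro closed_Int_compact closed_Int closed_Collect_le continuous_intros compact_cball) auto
  moreover have "A \<subseteq> slit_plane"
    using \<epsilon> by (auto simp: A_def intro!: in_slit_planeI)
  then have "continuous_on A (\<lambda>z. norm (g z) * norm (1 - z) powr (- c))"
    using \<epsilon>
    by (intro continuous_intros holomorphic_on_imp_continuous_on[OF holomorphic_on_subset[OF g]])
      (auto simp: A_def)
  ultimately have "bounded ((\<lambda>z. norm (g z) * norm (1 - z) powr (- c)) ` A)"
    by (intro compact_imp_bounded compact_continuous_image)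
  then obtain B where B: "\<And>z. z \<in> A \<Longrightarrow> norm (g z) * norm (1 - z) powr (- c) \<le> B"
    by (force simp: bounded_iff abs_le_iff)
  show ?thesis
  proof (rule that[of "\<bar>B\<bar>"])
    fix z assume z: "z \<in> wide_sector" "\<epsilon> \<le> norm (1 - z)" "norm (1 - z) \<le> b"
    then have "z \<in> A" by (simp add: A_def wide_sector_def dist_norm)
    then have "norm (g z) * norm (1 - z) powr (- c) \<le> \<bar>B\<bar>" using B by fastforce
    moreover have "norm (1 - z) > 0" using z \<epsilon> by linarith
    ultimately show "norm (g z) \<le> \<bar>B\<bar> * norm (1 - z) powr c"
      by (simp add: powr_minus_divide pos_divide_le_eq)
  qed simp
qed

definition approximates_gf ::
  "real \<Rightarrow> real \<Rightarrow> real \<Rightarrow> real \<Rightarrow> nat \<Rightarrow> (complex \<Rightarrow> complex) \<Rightarrow> bool" where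
  "approximates_gf p a \<epsilon> C n m \<longleftrightarrow>
     (\<forall>z\<in>wide_sector. 1 / (2 * real n) \<le> norm (1 - z) \<and> norm (1 - z) \<le> \<epsilon> \<longrightarrow>
        norm (1 / gf_denom p z - m z) \<le> C * norm (1 - z) powr (- a)) \<and>
     (\<forall>z\<in>wide_sector. \<epsilon> \<le> norm (1 - z) \<and> norm (1 - z) \<le> 3 \<longrightarrow>
        norm (m z) \<le> C * norm (1 - z) powr (- a))"

lemma norm_diff_le_of_approximates_gf:
  assumes approx: "approximates_gf p a \<epsilon> C n m"
    and nonneg: "0 \<le> B" "0 \<le> D" and a: "- 1 \<le> a" and \<epsilon>: "\<epsilon> \<le> 1"
    and near: "\<And>z. z \<in> slit_plane \<Longrightarrow> norm (1 - z) \<le> \<epsilon> \<Longrightarrow>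
                 norm (h z - 1 / gf_denom p z) \<le> D * norm (1 - z)"
    and far: "\<And>z. z \<in> wide_sector \<Longrightarrow> \<epsilon> \<le> norm (1 - z) \<Longrightarrow> norm (1 - z) \<le> 3 \<Longrightarrow>
                norm (h z) \<le> B * norm (1 - z) powr (- a)"
    and z: "z \<in> wide_sector" "1 / (2 * real n) \<le> norm (1 - z)" "norm (1 - z) \<le> 3"
  shows "norm (h z - m z) \<le> (C + B + D) * norm (1 - z) powr (- a)"
proof (cases "norm (1 - z) \<le> \<epsilon>")
  case True
  have "0 < norm (1 - z)" using z(1) one_notin_wide_sector by auto
  then have "norm (1 - z) \<le> norm (1 - z) powr (- a)"
    using powr_mono'[of "- a" 1 "norm (1 - z)"] a \<epsilon> True by simp
  then have "D * norm (1 - z) \<le> (B + D) * norm (1 - z) powr (- a)"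
    using nonneg by (intro mult_mono) auto
  moreover have "norm (h z - 1 / gf_denom p z) \<le> D * norm (1 - z)"
    using z(1) wide_sector_subset_slit_plane True by (intro near) auto
  moreover have "norm (1 / gf_denom p z - m z) \<le> C * norm (1 - z) powr (- a)"
    using approx z True by (simp add: approximates_gf_def)
  ultimately show ?thesis
    using norm_triangle_ineq[of "h z - 1 / gf_denom p z" "1 / gf_denom p z - m z"]
    by (simp add: distrib_right)
next
  case False
  then have "norm (m z) \<le> C * norm (1 - z) powr (- a)"
    using approx z by (simp add: approximates_gf_def)
  then have "norm (h z - m z) \<le> (C + B) * norm (1 - z) powr (- a)"
    using far[of z] z False norm_triangle_ineq4[of "h z" "m z"] by (simp add: distrib_right)
  also have "\<dots> \<le> (C + B + D) * norm (1 - z) powr (- a)"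
    using nonneg by (intro mult_right_mono) auto
  finally show ?thesis .
qed

text \<open>The constant \<open>K\<close> does not depend on the approximating function \<open>m\<close>, which may therefore vary
  with \<open>n\<close>; this is needed for \<open>p = 1/2\<close>.\<close>

lemma R_p_transfer_uniform:
  assumes p: "0 < p" "p < 1" and a: "- 1 \<le> a" and \<epsilon>: "0 < \<epsilon>" "\<epsilon> \<le> (1 - gf_pole p) / 2"
  obtains K where "\<And>n C m M. 3 \<le> n \<Longrightarrow> 0 \<le> C \<Longrightarrow> approximates_gf p a \<epsilon> C n m \<Longrightarrow>
    m holomorphic_on slit_plane \<Longrightarrow> m has_fps_expansion M \<Longrightarrow>
    norm (of_real (R_p p (Suc n)) - M $ n) \<le> K * (C + 1) * real n powr (a - 1)"
proof -
  obtain h D d where h: "h holomorphic_on slit_plane" and D: "0 \<le> D"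
    and h_fps: "h has_fps_expansion Abs_fps (\<lambda>m. complex_of_real (R_p p (Suc m))) + fps_const d"
    and near: "\<And>z. z \<in> slit_plane \<Longrightarrow> norm (1 - z) \<le> (1 - gf_pole p) / 2 \<Longrightarrow>
      norm (h z - 1 / gf_denom p z) \<le> D * norm (1 - z)"
    by (rule gf_regular_part[OF p], rule that)
  obtain B where B: "0 \<le> B" and far: "\<And>z. z \<in> wide_sector \<Longrightarrow> \<epsilon> \<le> norm (1 - z) \<Longrightarrow>
      norm (1 - z) \<le> 3 \<Longrightarrow> norm (h z) \<le> B * norm (1 - z) powr (- a)"
    using bounded_wide_sector_annulus[OF h \<epsilon>(1), where b = 3 and c = "- a"] by blast
  have \<epsilon>1: "\<epsilon> \<le> 1" using \<epsilon>(2) gf_pole_bounds[OF p] by simp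
  define Q where "Q = 3 ^ 7 * (3 / 2) powr \<bar>a\<bar>"
  show ?thesis
  proof (rule that[of "Q * (1 + B + D)"])
    fix n :: nat and C m M
    assume n: "3 \<le> n" and C: "0 \<le> C" and approx: "approximates_gf p a \<epsilon> C n m"
      and m: "m holomorphic_on slit_plane" "m has_fps_expansion M"
    have "(\<lambda>z. h z - m z) has_fps_expansion
        Abs_fps (\<lambda>m. complex_of_real (R_p p (Suc m))) + fps_const d - M"
      by (intro has_fps_expansion_diff h_fps m)
    from fps_nth_fps_expansion[OF this, of n]
    have "of_real (R_p p (Suc n)) - M $ n = (deriv ^^ n) (\<lambda>z. h z - m z) 0 / fact n"
      using n by simp
    also have "norm \<dots> \<le> Q * (C + B + D) * real n powr (a - 1)"
      unfolding Q_def
    proof (rule coeff_bound_wide_sector[OF a n])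
      show "(\<lambda>z. h z - m z) holomorphic_on wide_sector"
        by (rule holomorphic_on_subset[OF holomorphic_on_diff[OF h m(1)]
            wide_sector_subset_slit_plane])
      show "norm (h z - m z) \<le> (C + B + D) * norm (1 - z) powr (- a)"
        if "z \<in> wide_sector" "1 / (2 * real n) \<le> norm (1 - z)" "norm (1 - z) \<le> 3" for z
        using that near \<epsilon>(2) far
        by (intro norm_diff_le_of_approximates_gf[OF approx B D a \<epsilon>1]) auto
    qed (use B C D in simp)
    also have "\<dots> \<le> Q * ((1 + B + D) * (C + 1)) * real n powr (a - 1)"
      using B C D by (intro mult_right_mono mult_left_mono) (auto simp: algebra_simps Q_def)
    finally show "norm (of_real (R_p p (Suc n)) - M $ n) \<le>
        Q * (1 + B + D) * (C + 1) * real n powr (a - 1)"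
      by (simp only: mult.assoc)
  qed
qed

lemma norm_powr_of_real: "norm ((z :: complex) powr of_real s) = norm z powr s"
  by (simp add: norm_powr_real_powr')

lemma approximates_gf_of_bigo:
  assumes p: "0 < p" "p < 1" and m: "m holomorphic_on slit_plane"
    and near: "(\<lambda>z. 1 / gf_denom p z - m z)
        \<in> O[at 1 within wide_sector](\<lambda>z. (1 - z) powr of_real (- a))"
  obtains \<epsilon> C where "0 < \<epsilon>" "\<epsilon> \<le> (1 - gf_pole p) / 2" "0 \<le> C" "\<And>n. approximates_gf p a \<epsilon> C n m"
proof -
  obtain c where c: "0 < c" and "\<forall>\<^sub>F z in at 1 within wide_sector.
      norm (1 / gf_denom p z - m z) \<le> c * norm ((1 - z) powr of_real (- a))"
    using landau_o.bigE[OF near] by blast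
  then obtain \<delta> where \<delta>: "0 < \<delta>" and near': "\<And>z. z \<in> wide_sector \<Longrightarrow> z \<noteq> 1 \<Longrightarrow> dist z 1 < \<delta> \<Longrightarrow>
      norm (1 / gf_denom p z - m z) \<le> c * norm (1 - z) powr (- a)"
    unfolding eventually_at norm_powr_of_real by blast
  define \<epsilon> where "\<epsilon> = min (\<delta> / 2) ((1 - gf_pole p) / 2)"
  have \<epsilon>: "0 < \<epsilon>" "\<epsilon> \<le> (1 - gf_pole p) / 2" "\<epsilon> < \<delta>"
    using \<delta> gf_pole_bounds[OF p] by (auto simp: \<epsilon>_def min_def)
  obtain B where B: "0 \<le> B" and far: "\<And>z. z \<in> wide_sector \<Longrightarrow> \<epsilon> \<le> norm (1 - z) \<Longrightarrow>
      norm (1 - z) \<le> 3 \<Longrightarrow> norm (m z) \<le> B * norm (1 - z) powr (- a)"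
    using bounded_wide_sector_annulus[OF m \<epsilon>(1), where b = 3 and c = "- a"] by blast
  have weaken: "c * norm (1 - z) powr (- a) \<le> (c + B) * norm (1 - z) powr (- a)"
    "B * norm (1 - z) powr (- a) \<le> (c + B) * norm (1 - z) powr (- a)" for z :: complex
    using B c by (auto intro!: mult_right_mono)
  have "approximates_gf p a \<epsilon> (c + B) n m" for n
    unfolding approximates_gf_def
  proof (intro conjI ballI impI)
    fix z assume z: "z \<in> wide_sector" "1 / (2 * real n) \<le> norm (1 - z) \<and> norm (1 - z) \<le> \<epsilon>"
    then have "z \<noteq> 1" "dist z 1 < \<delta>"
      using \<epsilon>(3) one_notin_wide_sector by (auto simp: dist_norm norm_minus_commute)
    from near'[OF z(1) this] weaken(1)
    show "norm (1 / gf_denom p z - m z) \<le> (c + B) * norm (1 - z) powr (- a)" by (rule order_trans)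
  next
    fix z assume "z \<in> wide_sector" "\<epsilon> \<le> norm (1 - z) \<and> norm (1 - z) \<le> 3"
    then show "norm (m z) \<le> (c + B) * norm (1 - z) powr (- a)"
      using far weaken(2) by (blast intro: order_trans)
  qed
  then show ?thesis
    using that[OF \<epsilon>(1,2), of "c + B"] B c by simp
qed

theorem R_p_transfer:
  fixes b :: "nat \<Rightarrow> real"
  assumes p: "0 < p" "p < 1" and a: "- 1 \<le> a"
    and m: "m holomorphic_on slit_plane" "m has_fps_expansion Abs_fps (\<lambda>n. complex_of_real (b n))"
    and near: "(\<lambda>z. 1 / gf_denom p z - m z)
        \<in> O[at 1 within wide_sector](\<lambda>z. (1 - z) powr of_real (- a))"
  shows "(\<lambda>n. R_p p (Suc n) - b n) \<in> O(\<lambda>n. real n powr (a - 1))"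
proof -
  obtain \<epsilon> C where \<epsilon>: "0 < \<epsilon>" "\<epsilon> \<le> (1 - gf_pole p) / 2"
    and C: "0 \<le> C" "\<And>n. approximates_gf p a \<epsilon> C n m"
    using approximates_gf_of_bigo[OF p m(1) near] by blast
  obtain K where K: "\<And>n C m M. 3 \<le> n \<Longrightarrow> 0 \<le> C \<Longrightarrow> approximates_gf p a \<epsilon> C n m \<Longrightarrow>
      m holomorphic_on slit_plane \<Longrightarrow> m has_fps_expansion M \<Longrightarrow>
      norm (of_real (R_p p (Suc n)) - M $ n) \<le> K * (C + 1) * real n powr (a - 1)"
    using R_p_transfer_uniform[OF p a \<epsilon>] by blast
  have "norm (R_p p (Suc n) - b n) \<le> K * (C + 1) * norm (real n powr (a - 1))" if n: "3 \<le> n" for n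
    using K[OF n C m] by (simp flip: of_real_diff)
  then show ?thesis
    by (intro bigoI eventually_sequentiallyI)
qed

section \<open>Asymptotic expansions\<close>

lemma bigo_sequentially_SucI:
  fixes f g :: "nat \<Rightarrow> 'a::real_normed_field"
  assumes "(\<lambda>n. f (Suc n)) \<in> O(\<lambda>n. g (Suc n))"
  shows "f \<in> O(g)"
  using assms eventually_sequentially_Suc[where P = "\<lambda>n. norm (f n) \<le> c * norm (g n)" for c]
  by (auto elim!: landau_o.bigE)

lemma bigo_mult_tendsto:
  fixes f g h :: "'a \<Rightarrow> 'b::real_normed_field"
  assumes "\<forall>\<^sub>F x in F. f x = g x * h x" and "(g \<longlongrightarrow> L) F"
  shows "f \<in> O[F](h)"
proof -
  have "g \<in> O[F](\<lambda>_. 1)" using assms(2) by (intro bigoI_tendsto[where c = L]) simp_all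
  then have "(\<lambda>x. g x * h x) \<in> O[F](\<lambda>x. 1 * h x)" by (intro landau_o.big.mult) simp_all
  then show ?thesis using landau_o.big.in_cong[OF assms(1)] by simp
qed

lemma tendsto_one_minus_powr_0:
  assumes "0 < s"
  shows "((\<lambda>z::complex. (1 - z) powr of_real s) \<longlongrightarrow> 0) (at 1 within A)"
proof (rule tendsto_norm_zero_cancel)
  have "((\<lambda>z::complex. norm (1 - z)) \<longlongrightarrow> norm (1 - 1 :: complex)) (at 1 within A)"
    by (intro tendsto_intros)
  then have "((\<lambda>z::complex. norm (1 - z) powr s) \<longlongrightarrow> 0) (at 1 within A)"
    using assms by (intro tendsto_zero_powrI[OF _ tendsto_const]) auto
  then show "((\<lambda>z::complex. norm ((1 - z) powr of_real s)) \<longlongrightarrow> 0) (at 1 within A)"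
    by (simp add: norm_powr_of_real)
qed

subsection \<open>The case \<open>p > 1/2\<close>\<close>

lemma inverse_gf_denom_above_half_eq:
  fixes p :: real and z :: complex
  defines "P \<equiv> of_real p" and "q \<equiv> of_real (1 - p)" and "s \<equiv> of_real (2*p - 1)"
  defines "u \<equiv> (1 - z) powr s"
  assumes p: "p \<noteq> 1" "p \<noteq> 1/2" and z: "z \<noteq> 1" and nz: "P * u - q \<noteq> 0"
  shows "1 / gf_denom p z - of_real (- (2*p - 1) / (1 - p)) / (1 - z) =
           s * P / q / (P * u - q) * (1 - z) powr of_real (- (2 - 2*p))"
proof -
  have s_nz: "s \<noteq> 0" and q_nz: "q \<noteq> 0" using p unfolding s_def q_def of_real_eq_0_iff by simp_all
  have z_nz: "1 - z \<noteq> 0" using z by simp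
  have exponent: "complex_of_real (- (2 - 2*p)) = s - 1" by (simp add: s_def)
  have "complex_of_real (- (2*p - 1) / (1 - p)) = - (s / q)"
    by (simp only: q_def s_def of_real_divide of_real_minus minus_divide_left)
  moreover have "gf_denom p z = (1 - z) * ((P * u - q) / s)"
    using p by (simp add: gf_denom_def one_plus_psi_eq u_def P_def s_def q_def)
  moreover have "(1 - z) powr of_real (- (2 - 2*p)) = u / (1 - z)"
    unfolding exponent u_def powr_diff using z by simp
  moreover have "1 / (w * ((P * u - q) / s)) - - (s / q) / w = s * P / q / (P * u - q) * (u / w)"
    if "w \<noteq> 0" for w
    using that nz s_nz q_nz by (simp add: divide_simps) (simp add: algebra_simps)
  ultimately show ?thesis using z_nz by (simp only: not_False_eq_True)
qed

lemma inverse_gf_denom_above_half: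
  assumes p: "1/2 < p" "p < 1"
  shows "(\<lambda>z. 1 / gf_denom p z - of_real (- (2*p - 1) / (1 - p)) / (1 - z))
           \<in> O[at 1 within A](\<lambda>z. (1 - z) powr of_real (- (2 - 2*p)))"
proof (rule bigo_mult_tendsto)
  define P q s where "P = complex_of_real p" and "q = complex_of_real (1 - p)"
    and "s = complex_of_real (2*p - 1)"
  define u where "u = (\<lambda>z::complex. (1 - z) powr s)"
  have q_nz: "q \<noteq> 0" using p unfolding q_def of_real_eq_0_iff by simp
  have "((\<lambda>z. P * u z - q) \<longlongrightarrow> P * 0 - q) (at 1 within A)"
    using p unfolding u_def s_def by (intro tendsto_intros tendsto_one_minus_powr_0) simp
  then have lim: "((\<lambda>z. P * u z - q) \<longlongrightarrow> - q) (at 1 within A)" by simp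
  show "((\<lambda>z. s * P / q / (P * u z - q)) \<longlongrightarrow> s * P / q / (- q)) (at 1 within A)"
    using q_nz by (intro tendsto_intros lim) simp
  have "\<forall>\<^sub>F z in at 1 within A. P * u z - q \<noteq> 0"
    using q_nz by (intro tendsto_imp_eventually_ne[OF lim]) simp
  then show "\<forall>\<^sub>F z in at 1 within A. 1 / gf_denom p z - of_real (- (2*p - 1) / (1 - p)) / (1 - z) =
      s * P / q / (P * u z - q) * (1 - z) powr of_real (- (2 - 2*p))"
    using eventually_neq_at_within[of 1]
  proof eventually_elim
    case (elim z)
    then show ?case
      using inverse_gf_denom_above_half_eq[of p z] p unfolding P_def q_def s_def u_def by simp
  qed
qed

theorem R_p_asymptotics_above_half:
  assumes p: "1/2 < p" "p < 1"
  shows "(\<lambda>n. R_p p n - (- (2*p - 1) / (1 - p))) \<in> O(\<lambda>n. real n powr (1 - 2*p))"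
proof (rule bigo_sequentially_SucI)
  define c where "c = - (2*p - 1) / (1 - p)"
  have "(\<lambda>z. of_real c * (1 / (1 * (1 - z)))) has_fps_expansion
      fps_const (complex_of_real c) * Abs_fps (\<lambda>n. 1 / 1 * (1 / 1) ^ Suc n)"
    by (intro has_fps_expansion_cmult_left has_fps_expansion_simple_pole) simp_all
  also have "fps_const (complex_of_real c) * Abs_fps (\<lambda>n. 1 / 1 * (1 / 1) ^ Suc n) =
      Abs_fps (\<lambda>n. complex_of_real c)"
    by (simp add: fps_eq_iff)
  finally have "(\<lambda>z. of_real c / (1 - z)) has_fps_expansion Abs_fps (\<lambda>n. complex_of_real c)"
    by simp
  moreover have "(\<lambda>z. of_real c / (1 - z)) holomorphic_on slit_plane"
    using one_notin_slit_plane by (intro holomorphic_intros) auto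
  ultimately have "(\<lambda>n. R_p p (Suc n) - c) \<in> O(\<lambda>n. real n powr (2 - 2*p - 1))"
    using p inverse_gf_denom_above_half[OF p, folded c_def]
    by (intro R_p_transfer[where a = "2 - 2*p"]) simp_all
  also have "(\<lambda>n. real n powr (2 - 2*p - 1)) \<in> O(\<lambda>n. real (Suc n) powr (1 - 2*p))"
    by real_asymp
  finally show "(\<lambda>n. R_p p (Suc n) - (- (2*p - 1) / (1 - p))) \<in> O(\<lambda>n. real (Suc n) powr (1 - 2*p))"
    unfolding c_def .
qed

subsection \<open>The case \<open>p < 1/2\<close>\<close>

lemma inverse_gf_denom_below_half_eq:
  fixes p :: real and z :: complex
  defines "P \<equiv> of_real p" and "q \<equiv> of_real (1 - p)" and "s \<equiv> of_real (1 - 2*p)"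
  defines "u \<equiv> (1 - z) powr s"
  assumes p: "p \<noteq> 0" "p \<noteq> 1/2" and z: "z \<noteq> 1" and nz: "P - q * u \<noteq> 0"
  shows "1 / gf_denom p z - of_real (- (1 - 2*p) / p) * (1 - z) powr of_real (- (2*p)) =
           - s * q / P / (P - q * u) * (1 - z) powr of_real (- (4*p - 1))"
proof -
  have s_nz: "s \<noteq> 0" and P_nz: "P \<noteq> 0" using p unfolding s_def P_def of_real_eq_0_iff by simp_all
  have z_nz: "1 - z \<noteq> 0" and u_nz: "u \<noteq> 0" using z by (simp_all add: u_def)
  have exponents: "complex_of_real (- (4*p - 1)) = s + s - 1" "complex_of_real (- (2*p)) = s - 1"
    "complex_of_real (2*p - 1) = - s" by (simp_all add: s_def)
  have "complex_of_real (- (1 - 2*p) / p) = - (s / P)"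
    by (simp only: P_def s_def of_real_divide of_real_minus minus_divide_left)
  moreover have "gf_denom p z = (1 - z) * ((P * (1 / u) - q) / - s)"
    unfolding gf_denom_def u_def P_def q_def powr_minus_divide[symmetric] exponents(3)[symmetric]
    using p by (subst one_plus_psi_eq) auto
  moreover have "P * (1 / u) - q = (P - q * u) / u" using u_nz by (simp add: field_simps)
  moreover have "(1 - z) powr of_real (- (4*p - 1)) = u * u / (1 - z)"
    "(1 - z) powr of_real (- (2*p)) = u / (1 - z)"
    unfolding exponents u_def powr_diff powr_add using z by simp_all
  moreover have "1 / (w * ((P - q * u) / u / - s)) - - (s / P) * (u / w) =
      - s * q / P / (P - q * u) * (u * u / w)" if "w \<noteq> 0" for w
    using that nz s_nz P_nz u_nz by (simp add: divide_simps) (simp add: algebra_simps)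
  ultimately show ?thesis using z_nz by (simp only: not_False_eq_True)
qed

lemma inverse_gf_denom_below_half:
  assumes p: "0 < p" "p < 1/2"
  shows "(\<lambda>z. 1 / gf_denom p z - of_real (- (1 - 2*p) / p) * (1 - z) powr of_real (- (2*p)))
           \<in> O[at 1 within A](\<lambda>z. (1 - z) powr of_real (- (4*p - 1)))"
proof (rule bigo_mult_tendsto)
  define P q s where "P = complex_of_real p" and "q = complex_of_real (1 - p)"
    and "s = complex_of_real (1 - 2*p)"
  define u where "u = (\<lambda>z::complex. (1 - z) powr s)"
  have P_nz: "P \<noteq> 0" using p by (simp add: P_def)
  have "((\<lambda>z. P - q * u z) \<longlongrightarrow> P - q * 0) (at 1 within A)"
    using p unfolding u_def s_def by (intro tendsto_intros tendsto_one_minus_powr_0) simp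
  then have lim: "((\<lambda>z. P - q * u z) \<longlongrightarrow> P) (at 1 within A)" by simp
  show "((\<lambda>z. - s * q / P / (P - q * u z)) \<longlongrightarrow> - s * q / P / P) (at 1 within A)"
    using P_nz by (intro tendsto_intros lim)
  have "\<forall>\<^sub>F z in at 1 within A. P - q * u z \<noteq> 0"
    by (rule tendsto_imp_eventually_ne[OF lim P_nz])
  then show "\<forall>\<^sub>F z in at 1 within A.
      1 / gf_denom p z - of_real (- (1 - 2*p) / p) * (1 - z) powr of_real (- (2*p)) =
      - s * q / P / (P - q * u z) * (1 - z) powr of_real (- (4*p - 1))"
    using eventually_neq_at_within[of 1]
  proof eventually_elim
    case (elim z)
    then show ?case
      using inverse_gf_denom_below_half_eq[of p z] p unfolding P_def q_def s_def u_def by simp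
  qed
qed

lemma has_fps_expansion_one_minus_powr:
  "(\<lambda>z. (1 - z) powr of_real c) has_fps_expansion
     Abs_fps (\<lambda>n. complex_of_real ((-1) ^ n * (c gchoose n)))"
proof -
  have "((\<lambda>z. (1 + z) powr complex_of_real c) \<circ> (\<lambda>z. - z)) has_fps_expansion
      fps_one_minus_powr (of_real c)"
    unfolding fps_one_minus_powr_def by (intro has_fps_expansion_compose fps_expansion_intros) simp
  moreover have "fps_one_minus_powr (complex_of_real c) =
      Abs_fps (\<lambda>n. complex_of_real ((-1) ^ n * (c gchoose n)))"
    by (simp add: fps_eq_iff gbinomial_prod_rev)
  ultimately show ?thesis by (simp add: o_def)
qed

text \<open>Log-convexity of \<open>\<Gamma>\<close>, applied to the point \<open>x + q\<close> of the segments from \<open>x\<close> to \<open>x + 1\<close>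
  and to the point \<open>x + 1\<close> of the segment from \<open>x + q\<close> to \<open>x + q + 1\<close>.\<close>

lemma Gamma_ratio_bounds:
  fixes x q :: real
  assumes x: "0 < x" and q: "0 \<le> q" "q \<le> 1"
  shows "Gamma (x + q) \<le> x powr q * Gamma x"
    and "x * Gamma x \<le> (x + q) powr (1 - q) * Gamma (x + q)"
proof -
  have convex: "Gamma ((1 - t) * y + t * (y + 1)) \<le> y powr t * Gamma y"
    if "0 < y" "0 \<le> t" "t \<le> 1" for y t :: real
  proof -
    have "(ln \<circ> Gamma) ((1 - t) *\<^sub>R y + t *\<^sub>R (y + 1)) \<le>
        (1 - t) * (ln \<circ> Gamma) y + t * (ln \<circ> Gamma) (y + 1)"
      using that by (intro convex_onD[OF log_convex_Gamma_real]) auto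
    also have "\<dots> = ln (y powr t * Gamma y)"
      using that Gamma_real_pos[of y] Gamma_plus1[of y]
      by (simp add: ln_mult algebra_simps nonpos_Ints_def)
    finally show ?thesis
      using that Gamma_real_pos[of y] Gamma_real_pos[of "(1 - t) * y + t * (y + 1)"]
      by (simp add: algebra_simps)
  qed
  show "Gamma (x + q) \<le> x powr q * Gamma x"
    using convex[OF x q] by (simp add: algebra_simps)
  have "Gamma (x + 1) \<le> (x + q) powr (1 - q) * Gamma (x + q)"
    using convex[of "x + q" "1 - q"] x q by (simp add: algebra_simps)
  then show "x * Gamma x \<le> (x + q) powr (1 - q) * Gamma (x + q)"
    using Gamma_plus1[of x] x by (simp add: nonpos_Ints_def)
qed

lemma gbinomial_minus_bounds:
  fixes q :: real and n :: nat
  assumes q: "0 < q" "q \<le> 1" and n: "0 < n"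
  shows "(-1) ^ n * ((- q) gchoose n) \<le> real n powr (q - 1) / Gamma q"
    and "(real n + 1) powr (q - 1) / Gamma q \<le> (-1) ^ n * ((- q) gchoose n)"
proof -
  have "(-1) ^ n * ((- q) gchoose n) = pochhammer q n / fact n"
    by (simp add: gbinomial_pochhammer)
  also have "pochhammer q n = Gamma (q + real n) / Gamma q"
    using q by (intro pochhammer_Gamma) auto
  also have "fact n = real n * Gamma (real n)"
    using n Gamma_fact[of n, where 'a = real] Gamma_plus1[of "real n"]
    by (simp add: add.commute of_nat_in_nonpos_Ints_iff)
  finally have coeff: "(-1) ^ n * ((- q) gchoose n) =
      Gamma (real n + q) / (real n * Gamma (real n)) / Gamma q"
    by (simp add: add.commute)
  have pos: "0 < Gamma q" "0 < real n * Gamma (real n)" using q n by simp_all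
  note ratio = Gamma_ratio_bounds[of "real n" q]
  have "Gamma (real n + q) \<le> real n powr (q - 1) * (real n * Gamma (real n))"
    using ratio(1) q n by (simp add: powr_diff)
  then show "(-1) ^ n * ((- q) gchoose n) \<le> real n powr (q - 1) / Gamma q"
    unfolding coeff using pos by (intro divide_right_mono) (simp_all add: pos_divide_le_eq)
  have "(real n + q) powr (q - 1) * (real n * Gamma (real n)) \<le>
      (real n + q) powr (q - 1) * ((real n + q) powr (1 - q) * Gamma (real n + q))"
    using ratio(2) q n by (intro mult_left_mono) auto
  also have "\<dots> = Gamma (real n + q)"
    using q by (simp flip: powr_add mult.assoc)
  finally have "(real n + q) powr (q - 1) \<le> Gamma (real n + q) / (real n * Gamma (real n))"
    using pos by (simp add: pos_le_divide_eq)
  moreover have "(real n + 1) powr (q - 1) \<le> (real n + q) powr (q - 1)"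
    using q n by (intro powr_mono2') auto
  ultimately show "(real n + 1) powr (q - 1) / Gamma q \<le> (-1) ^ n * ((- q) gchoose n)"
    unfolding coeff using pos by (intro divide_right_mono) auto
qed

lemma gbinomial_minus_asymptotics:
  fixes q :: real
  assumes q: "0 < q" "q \<le> 1"
  shows "(\<lambda>n. (-1) ^ n * ((- q) gchoose n) - real (Suc n) powr (q - 1) / Gamma q)
           \<in> O(\<lambda>n. real n powr (q - 2))"
proof -
  have "(\<lambda>n. (-1) ^ n * ((- q) gchoose n) - real (Suc n) powr (q - 1) / Gamma q) \<in>
      O(\<lambda>n. real n powr (q - 1) - real (Suc n) powr (q - 1))"
  proof (intro bigoI[where c = "1 / Gamma q"] eventually_sequentiallyI[where c = 1])
    fix n :: nat assume "1 \<le> n"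
    then have "norm ((-1) ^ n * ((- q) gchoose n) - real (Suc n) powr (q - 1) / Gamma q) \<le>
        norm (real n powr (q - 1) / Gamma q - real (Suc n) powr (q - 1) / Gamma q)"
      using gbinomial_minus_bounds[OF q, of n] by (simp add: add.commute)
    also have "\<dots> = 1 / Gamma q * norm (real n powr (q - 1) - real (Suc n) powr (q - 1))"
      using Gamma_real_pos[OF q(1)] by (simp flip: diff_divide_distrib)
    finally show "norm ((-1) ^ n * ((- q) gchoose n) - real (Suc n) powr (q - 1) / Gamma q) \<le>
        1 / Gamma q * norm (real n powr (q - 1) - real (Suc n) powr (q - 1))" .
  qed
  also have "(\<lambda>n. real n powr (q - 1) - real (Suc n) powr (q - 1)) \<in> O(\<lambda>n. real n powr (q - 2))"
    by real_asymp
  finally show ?thesis .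
qed

theorem R_p_asymptotics_below_half:
  assumes p: "0 < p" "p < 1/2"
  shows "(\<lambda>n. R_p p n - (- (1 - 2*p) / (p * Gamma (2*p)) * real n powr (2*p - 1)))
           \<in> O(\<lambda>n. real n powr (2 * (2*p - 1)))"
proof (rule bigo_sequentially_SucI)
  define c where "c = - (1 - 2*p) / p"
  define b where "b = (\<lambda>n. (-1) ^ n * ((- (2*p)) gchoose n))"
  have "(\<lambda>z. of_real c * (1 - z) powr of_real (- (2*p))) has_fps_expansion
      fps_const (of_real c) * Abs_fps (\<lambda>n. complex_of_real (b n))"
    unfolding b_def by (intro has_fps_expansion_cmult_left has_fps_expansion_one_minus_powr)
  also have "fps_const (of_real c) * Abs_fps (\<lambda>n. complex_of_real (b n)) =
      Abs_fps (\<lambda>n. complex_of_real (c * b n))"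
    by (simp add: fps_eq_iff)
  finally have fps: "(\<lambda>z. of_real c * (1 - z) powr of_real (- (2*p))) has_fps_expansion
      Abs_fps (\<lambda>n. complex_of_real (c * b n))" .
  have "(\<lambda>z. of_real c * (1 - z) powr of_real (- (2*p))) holomorphic_on slit_plane"
    by (intro holomorphic_intros) (simp add: slit_plane_def)
  then have "(\<lambda>n. R_p p (Suc n) - c * b n) \<in> O(\<lambda>n. real n powr (4*p - 1 - 1))"
    using p inverse_gf_denom_below_half[OF p, folded c_def] fps
    by (intro R_p_transfer[where a = "4*p - 1"]) simp_all
  moreover have "(\<lambda>n. c * (b n - real (Suc n) powr (2*p - 1) / Gamma (2*p)))
      \<in> O(\<lambda>n. real n powr (4*p - 1 - 1))"
  proof -
    have "(\<lambda>n. b n - real (Suc n) powr (2*p - 1) / Gamma (2*p)) \<in> O(\<lambda>n. real n powr (2*p - 2))"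
      unfolding b_def using p by (intro gbinomial_minus_asymptotics) auto
    also have "(\<lambda>n. real n powr (2*p - 2)) \<in> O(\<lambda>n. real n powr (4*p - 1 - 1))"
      using p by real_asymp
    finally show ?thesis by simp
  qed
  ultimately have "(\<lambda>n. (R_p p (Suc n) - c * b n) +
      c * (b n - real (Suc n) powr (2*p - 1) / Gamma (2*p))) \<in> O(\<lambda>n. real n powr (4*p - 1 - 1))"
    by (rule sum_in_bigo)
  then have "(\<lambda>n. R_p p (Suc n) - (- (1 - 2*p) / (p * Gamma (2*p)) * real (Suc n) powr (2*p - 1)))
      \<in> O(\<lambda>n. real n powr (4*p - 1 - 1))"
    by (simp add: c_def right_diff_distrib)
  also have "(\<lambda>n. real n powr (4*p - 1 - 1)) \<in> O(\<lambda>n. real (Suc n) powr (2 * (2*p - 1)))"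
    by real_asymp
  finally show "(\<lambda>n. R_p p (Suc n) -
        (- (1 - 2*p) / (p * Gamma (2*p)) * real (Suc n) powr (2*p - 1)))
      \<in> O(\<lambda>n. real (Suc n) powr (2 * (2*p - 1)))" .
qed

subsection \<open>The case \<open>p = 1/2\<close>\<close>

lemma abs_ln_plus_4_le:
  fixes x :: real
  assumes "1/2 \<le> x"
  shows "\<bar>ln x\<bar> + 4 \<le> 12 * x powr (1/4)"
proof -
  have x0: "0 < x" using assms by linarith
  have "(1/2) powr (4 * (1/4)) = ((1/2) powr 4) powr (1/4 :: real)" unfolding powr_powr ..
  also have "\<dots> \<le> x powr (1/4)" using assms by (intro powr_mono2) (simp_all add: power_divide)
  finally have ge: "1 \<le> 2 * x powr (1/4)" by simp
  have "\<bar>ln x\<bar> \<le> 4 * x powr (1/4)"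
  proof (cases "1 \<le> x")
    case True
    have "ln x = 4 * ln (x powr (1/4))" using x0 by simp
    also have "ln (x powr (1/4)) \<le> x powr (1/4) - 1" using x0 by (intro ln_le_minus_one) simp
    finally show ?thesis using True by simp
  next
    case False
    have "- ln x = ln (1 / x)" using x0 by (simp add: ln_div)
    also have "\<dots> \<le> 1 / x - 1" using x0 by (intro ln_le_minus_one) simp
    also have "\<dots> \<le> 1" using assms x0 by (simp add: field_simps)
    finally have "- ln x \<le> 1" .
    moreover have "ln x \<le> 0" using False x0 by simp
    ultimately show ?thesis using ge by linarith
  qed
  then show ?thesis using ge by linarith
qed

text \<open>Near \<open>1\<close> on the scale \<open>1 - z \<approx> 1/n\<close>, the slowly varying factor \<open>1 + Ln (1 - z) / 2\<close> is
  replaced by its value at that scale.\<close>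

lemma inverse_gf_denom_half_diff_bound:
  fixes l :: real and z :: complex
  defines "r \<equiv> norm (1 - z)"
  defines "y \<equiv> \<bar>l + ln r\<bar> + 4"
  assumes l: "4 \<le> l" and z: "z \<noteq> 1" "r \<le> exp (- 4)"
  shows "norm (1 / gf_denom (1/2) z - 1 / (of_real (1 - l / 2) * (1 - z))) \<le> 8 * y\<^sup>2 / (r * l\<^sup>2)"
proof -
  define t where "t = - ln r"
  define L where "L = Ln (1 - z)"
  define A where "A = 1 + L / 2"
  define c where "c = 1 - l / 2"
  have r: "0 < r" using z by (simp add: r_def)
  have "ln r \<le> ln (exp (- 4))" using z(2) r by (subst ln_le_cancel_iff) auto
  then have t: "4 \<le> t" by (simp add: t_def)
  have ReL: "Re L = - t" using z(1) by (simp add: L_def t_def r_def)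
  then have "t / 4 \<le> \<bar>Re A\<bar>" using t by (simp add: A_def)
  then have A_ge: "t / 4 \<le> norm A" using abs_Re_le_cmod[of A] by linarith
  have c_ge: "l / 4 \<le> \<bar>c\<bar>" using l by (simp add: c_def)
  have "of_real c - A = - ((of_real l + L) / 2)" by (simp add: c_def A_def field_simps)
  then have "norm (of_real c - A) = norm (of_real l + L) / 2"
    by (simp only: norm_minus_cancel norm_divide) simp
  also have "norm (of_real l + L) \<le> \<bar>Re (of_real l + L)\<bar> + \<bar>Im (of_real l + L)\<bar>" by (rule cmod_le)
  also have "\<dots> \<le> y"
    using z(1) mpi_less_Im_Ln[of "1 - z"] Im_Ln_le_pi[of "1 - z"] pi_less_4 ReL
    by (simp add: y_def L_def t_def)
  finally have diff_le: "norm (of_real c - A) \<le> y / 2" by simp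
  have gf_denom_eq: "gf_denom (1/2) z = (1 - z) * A" by (simp add: gf_denom_def psi_def A_def L_def)
  have "1 - z \<noteq> 0" "A \<noteq> 0" "complex_of_real c \<noteq> 0" using z(1) A_ge t c_ge l by auto
  then have "1 / gf_denom (1/2) z - 1 / (of_real c * (1 - z)) =
      (of_real c - A) / ((1 - z) * A * of_real c)"
    unfolding gf_denom_eq by (simp add: divide_simps)
  then have "norm (1 / gf_denom (1/2) z - 1 / (of_real c * (1 - z))) =
      norm (of_real c - A) / (r * norm A * \<bar>c\<bar>)"
    by (simp add: norm_divide norm_mult r_def)
  also have "\<dots> \<le> y / 2 / (r * (t / 4) * (l / 4))"
    using diff_le A_ge c_ge l t r by (intro frac_le mult_mono) (auto simp: y_def)
  also have "\<dots> = 8 * y / (r * l) * (1 / t)" using t l r by (simp add: field_simps)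
  also have "\<dots> \<le> 8 * y / (r * l) * (y / l)"
  proof (rule mult_left_mono)
    have "l \<le> \<bar>l - t\<bar> * 1 + t" by simp
    also have "\<dots> \<le> \<bar>l - t\<bar> * t + 4 * t" using t by (intro add_mono mult_left_mono) auto
    finally show "1 / t \<le> y / l" using t l by (simp add: y_def t_def field_simps)
  qed (use l r in \<open>auto simp: y_def\<close>)
  finally show ?thesis by (simp add: power2_eq_square c_def)
qed

lemma inverse_gf_denom_half_bound:
  fixes n :: nat and z :: complex
  defines "l \<equiv> ln (real n)"
  assumes l: "4 \<le> l" and z: "z \<noteq> 1" "1 / (2 * real n) \<le> norm (1 - z)" "norm (1 - z) \<le> exp (- 4)"
  shows "norm (1 / gf_denom (1/2) z - 1 / (of_real (1 - l / 2) * (1 - z)))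
           \<le> 1152 * (real n powr (1/2) / l\<^sup>2) * norm (1 - z) powr (- (1/2))"
proof -
  define r where "r = norm (1 - z)"
  have n: "0 < real n" using l by (cases "n = 0") (simp_all add: l_def)
  have r: "0 < r" using z by (simp add: r_def)
  have "1/2 \<le> real n * r" using z(2) n by (simp add: r_def field_simps)
  then have "\<bar>l + ln r\<bar> + 4 \<le> 12 * (real n * r) powr (1/4)"
    using abs_ln_plus_4_le[of "real n * r"] n r by (simp add: l_def ln_mult)
  then have "(\<bar>l + ln r\<bar> + 4)\<^sup>2 \<le> (12 * (real n * r) powr (1/4))\<^sup>2"
    by (rule power_mono) simp
  also have "\<dots> = 144 * (real n * r) powr (1/2)"
    by (simp add: power2_eq_square flip: powr_add)
  finally have "8 * (\<bar>l + ln r\<bar> + 4)\<^sup>2 / (r * l\<^sup>2) \<le>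
      8 * (144 * (real n * r) powr (1/2)) / (r * l\<^sup>2)"
    using r by (intro divide_right_mono mult_left_mono) auto
  also have "\<dots> = 1152 * (real n powr (1/2) / l\<^sup>2) * (r powr (1/2) / r)"
    using n r by (simp add: powr_mult mult_ac)
  also have "r powr (1/2) / r = r powr (- (1/2))"
    using powr_diff[of r "1/2" 1] r by simp
  finally show ?thesis
    using inverse_gf_denom_half_diff_bound[OF l z(1,3)] unfolding r_def
    by (rule order_trans[rotated])
qed

lemma approximates_gf_half:
  fixes n :: nat
  defines "l \<equiv> ln (real n)"
  assumes l: "4 \<le> l"
  shows "approximates_gf (1/2) (1/2) (exp (- 4)) (1152 * (real n powr (1/2) / l\<^sup>2) + exp 2) n
           (\<lambda>z. 1 / (of_real (1 - l / 2) * (1 - z)))"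
  unfolding approximates_gf_def
proof (intro conjI ballI impI)
  fix z assume z: "z \<in> wide_sector" "1 / (2 * real n) \<le> norm (1 - z) \<and> norm (1 - z) \<le> exp (- 4)"
  have "norm (1 / gf_denom (1/2) z - 1 / (of_real (1 - l / 2) * (1 - z)))
      \<le> 1152 * (real n powr (1/2) / l\<^sup>2) * norm (1 - z) powr (- (1/2))"
    unfolding l_def using l z one_notin_wide_sector
    by (intro inverse_gf_denom_half_bound) (auto simp: l_def)
  also have "\<dots> \<le> (1152 * (real n powr (1/2) / l\<^sup>2) + exp 2) * norm (1 - z) powr (- (1/2))"
    by (intro mult_right_mono) auto
  finally show "norm (1 / gf_denom (1/2) z - 1 / (of_real (1 - l / 2) * (1 - z)))
      \<le> (1152 * (real n powr (1/2) / l\<^sup>2) + exp 2) * norm (1 - z) powr (- (1/2))" .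
next
  fix z assume z: "z \<in> wide_sector" "exp (- 4) \<le> norm (1 - z) \<and> norm (1 - z) \<le> 3"
  define w where "w = norm (1 - z) powr (- (1/2))"
  have r: "0 < norm (1 - z)" using z(1) one_notin_wide_sector by auto
  have "norm (complex_of_real (1 - l / 2)) \<ge> 1" unfolding norm_of_real using l by simp
  then have "norm (1 / (of_real (1 - l / 2) * (1 - z))) \<le> 1 / norm (1 - z)"
    using r unfolding norm_divide norm_mult by (intro frac_le) auto
  also have "\<dots> = w * w" using r by (simp add: w_def powr_minus_divide flip: powr_add)
  also have "\<dots> \<le> exp 2 * w"
  proof (rule mult_right_mono)
    have "w \<le> exp (- 4) powr (- (1/2))" unfolding w_def using z(2) by (intro powr_mono2') auto
    then show "w \<le> exp 2" by (simp add: powr_def)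
  qed (simp add: w_def)
  also have "\<dots> \<le> (1152 * (real n powr (1/2) / l\<^sup>2) + exp 2) * w"
    by (intro mult_right_mono) (auto simp: w_def)
  finally show "norm (1 / (of_real (1 - l / 2) * (1 - z)))
      \<le> (1152 * (real n powr (1/2) / l\<^sup>2) + exp 2) * norm (1 - z) powr (- (1/2))"
    by (simp only: w_def)
qed

lemma exp_minus_4_le_gf_pole_half: "exp (- 4) \<le> (1 - gf_pole (1/2)) / 2"
proof -
  have "exp (- 4 :: real) * 2 \<le> exp (- 4) * exp 2"
    using exp_ge_add_one_self[of 2] by (intro mult_left_mono) auto
  then show ?thesis by (simp add: gf_pole_def pole_log_def flip: exp_add)
qed

lemma R_p_half_bigo:
  "(\<lambda>n. R_p (1/2) (Suc n) - 1 / (1 - ln (real n) / 2)) \<in> O(\<lambda>n. 1 / (ln (real n))\<^sup>2)"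
proof -
  define C where "C = (\<lambda>n. 1152 * (real n powr (1/2) / (ln (real n))\<^sup>2) + exp 2)"
  have C_nonneg: "0 \<le> C n" for n by (simp add: C_def)
  obtain K where K: "\<And>n C m M. 3 \<le> n \<Longrightarrow> 0 \<le> C \<Longrightarrow> approximates_gf (1/2) (1/2) (exp (- 4)) C n m \<Longrightarrow>
      m holomorphic_on slit_plane \<Longrightarrow> m has_fps_expansion M \<Longrightarrow>
      norm (of_real (R_p (1/2) (Suc n)) - M $ n) \<le> K * (C + 1) * real n powr (1/2 - 1)"
    using R_p_transfer_uniform[OF _ _ _ _ exp_minus_4_le_gf_pole_half, of "1/2"] by auto
  have bound: "norm (R_p (1/2) (Suc n) - 1 / (1 - ln (real n) / 2)) \<le>
      K * norm ((C n + 1) * real n powr (1/2 - 1))" if n: "3 \<le> n" "4 \<le> ln (real n)" for n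
  proof -
    define c where "c = 1 - ln (real n) / 2"
    have c_nz: "complex_of_real c \<noteq> 0" using n(2) unfolding c_def of_real_eq_0_iff by simp
    have "norm (of_real (R_p (1/2) (Suc n))
        - Abs_fps (\<lambda>n. 1 / complex_of_real c * (1 / 1) ^ Suc n) $ n) \<le>
        K * (C n + 1) * real n powr (1/2 - 1)"
    proof (rule K[OF n(1) C_nonneg])
      show "approximates_gf (1/2) (1/2) (exp (- 4)) (C n) n (\<lambda>z. 1 / (of_real c * (1 - z)))"
        unfolding C_def c_def by (rule approximates_gf_half[OF n(2)])
      show "(\<lambda>z. 1 / (of_real c * (1 - z))) holomorphic_on slit_plane"
        using c_nz one_notin_slit_plane by (intro holomorphic_intros) auto
    qed (use c_nz in \<open>intro has_fps_expansion_simple_pole; simp\<close>)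
    then have "norm (complex_of_real (R_p (1/2) (Suc n) - 1 / c)) \<le>
        K * ((C n + 1) * real n powr (1/2 - 1))"
      by (simp add: mult.assoc)
    then show ?thesis using C_nonneg[of n] unfolding norm_of_real c_def by (simp add: abs_mult)
  qed
  have "\<forall>\<^sub>F n in sequentially. 4 \<le> ln (real n)" by real_asymp
  with eventually_ge_at_top[of 3]
  have "\<forall>\<^sub>F n in sequentially. norm (R_p (1/2) (Suc n) - 1 / (1 - ln (real n) / 2)) \<le>
      K * norm ((C n + 1) * real n powr (1/2 - 1))"
    by eventually_elim (rule bound)
  then have "(\<lambda>n. R_p (1/2) (Suc n) - 1 / (1 - ln (real n) / 2))
      \<in> O(\<lambda>n. (C n + 1) * real n powr (1/2 - 1))"
    by (rule bigoI)
  also have "(\<lambda>n. (C n + 1) * real n powr (1/2 - 1)) \<in> O(\<lambda>n. 1 / (ln (real n))\<^sup>2)"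
    unfolding C_def by real_asymp
  finally show ?thesis .
qed

theorem R_p_asymptotics_half:
  "(\<lambda>n. R_p (1/2) n - (- 2 / ln (real n))) \<in> O(\<lambda>n. 1 / (ln (real n))\<^sup>2)"
proof (rule bigo_sequentially_SucI)
  have "(\<lambda>n. 1 / (1 - ln (real n) / 2) - (- 2 / ln (real (Suc n)))) \<in> O(\<lambda>n. 1 / (ln (real n))\<^sup>2)"
    by real_asymp
  from sum_in_bigo(1)[OF R_p_half_bigo this]
  have "(\<lambda>n. R_p (1/2) (Suc n) - (- 2 / ln (real (Suc n)))) \<in> O(\<lambda>n. 1 / (ln (real n))\<^sup>2)"
    by simp
  also have "(\<lambda>n. 1 / (ln (real n))\<^sup>2) \<in> O(\<lambda>n. 1 / (ln (real (Suc n)))\<^sup>2)"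
    by real_asymp
  finally show "(\<lambda>n. R_p (1/2) (Suc n) - (- 2 / ln (real (Suc n))))
      \<in> O(\<lambda>n. 1 / (ln (real (Suc n)))\<^sup>2)" .
qed

section \<open>The expected number of paths\<close>

theorem theorem3:
  fixes p :: real
  assumes "0 < p" and "p < 1"
  shows "(p \<noteq> 1/2 \<longrightarrow> (\<forall>n\<ge>1. EP p n =
            (\<Sum>j=0..n-1. (-1) ^ (n + j - 1) * (((2*p - 1) * real j - 1) gchoose (n - 1))
               * (\<Sum>k=0..n-1. real (k choose j) * (p / (2*p - 1)) ^ k))))
       \<and> (p = 1/2 \<longrightarrow> (\<forall>n\<ge>1. EP p n =
            (\<Sum>k=0..n-1. (-1) ^ k / 2 ^ k *
               complete_bell k (\<lambda>m. - fact (m - 1) * gen_harmonic m (n - 1)))))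
       \<and> (p < 1/2 \<longrightarrow>
            (\<lambda>n. R_p p n - (- (1 - 2*p) / (p * Gamma (2*p)) * real n powr (2*p - 1)))
              \<in> O(\<lambda>n. real n powr (2 * (2*p - 1))))
       \<and> (p = 1/2 \<longrightarrow>
            (\<lambda>n. R_p p n - (- 2 / ln (real n))) \<in> O(\<lambda>n. 1 / (ln (real n))^2))
       \<and> (1/2 < p \<longrightarrow>
            (\<lambda>n. R_p p n - (- (2*p - 1) / (1 - p))) \<in> O(\<lambda>n. real n powr (1 - 2*p)))"
proof (intro conjI impI allI)
  fix n :: nat assume "p \<noteq> 1/2" "n \<ge> 1"
  then show "EP p n = (\<Sum>j=0..n-1. (-1) ^ (n + j - 1) * (((2*p - 1) * real j - 1) gchoose (n - 1))
               * (\<Sum>k=0..n-1. real (k choose j) * (p / (2*p - 1)) ^ k))"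
    using EP_eq_sum_gbinomial[of p "n - 1"] assms by (simp add: atMost_atLeast0)
next
  fix n :: nat assume p: "p = 1/2" and "n \<ge> 1"
  then show "EP p n = (\<Sum>k=0..n-1. (-1) ^ k / 2 ^ k *
               complete_bell k (\<lambda>m. - fact (m - 1) * gen_harmonic m (n - 1)))"
    unfolding p using EP_half_eq_sum_complete_bell[of "n - 1"] by (simp add: atMost_atLeast0)
next
  assume "p = 1/2"
  then show "(\<lambda>n. R_p p n - (- 2 / ln (real n))) \<in> O(\<lambda>n. 1 / (ln (real n))^2)"
    using R_p_asymptotics_half by blast
qed (use assms R_p_asymptotics_below_half R_p_asymptotics_above_half in blast)+

end
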